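(* Let $\mu:[0,\infty)\to[0,\infty)$ be a smooth function. Let $(f_i^{(n)})_{0\le i\le 8,\ n\ge 0}$ be smooth functions of $(x,t)$, spatially periodic in $x\in\mathbb{R}^2$, $t\in[0,T]$, with $f_i^{(0)}=w_i$, which are the coefficients of a formal expansion $f_i\sim\sum_{n\ge0}h^nf_i^{(n)}$ solving, to all orders in $h$, the D2Q9 lattice Boltzmann equation with time step $h^2$ and either the first collision term (hierarchy (I) of the context) or the second collision term (constant relaxation time $\tau>0$, hierarchy (II) of the context). Put $\rho^{(n)}=\sum_{i}f_i^{(n)}$, $v^{(n)}=\sum_i c_if_i^{(n)}$, $S^{(n)}=\nabla v^{(n)}+(\nabla v^{(n)})^t$, and assume $\rho^{(1)}|_{t=0}=0$. Then, for both collision terms, $\rho^{(1)}\equiv0$ and $(\rho^{(2)},v^{(1)})$ satisfies the incompressible generalized Navier–Stokes equations $$\nabla\cdot v^{(1)}=0,\qquad \frac{\partial v^{(1)}}{\partial t}+\nabla\frac{\rho^{(2)}}{3}+v^{(1)}\cdot\nabla v^{(1)}=\nabla\cdot\Big[\mu\big(\mathrm{tr}((S^{(1)})^2)\big)S^{(1)}\Big].$$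
   Context: **D2Q9 lattice.** $c_0=(0,0)$; $c_1,\dots,c_4=(1,0),(0,1),(-1,0),(0,-1)$; $c_5,\dots,c_8=(1,1),(-1,1),(-1,-1),(1,-1)$. Weights: $w_0=\tfrac{16}{36}$, $w_1=\dots=w_4=\tfrac{4}{36}$, $w_5=\dots=w_8=\tfrac1{36}$. **Lattice Boltzmann equation.** $f_i(x+c_ih,t+h^2)-f_i(x,t)=\Omega_i(x,t)$, $i=0,\dots,8$, with lattice spacing $h$. Write $\rho=\sum_if_i$, $v=\sum_ic_if_i$, $S=\nabla v+(\nabla v)^t$, $$f_{iL}(\rho,v)=w_i(\rho+3c_i\cdot v),\qquad f_{iQ}(u,v)=w_i\big[\tfrac92(c_i\cdot u)(c_i\cdot v)-\tfrac32u\cdot v\big].$$ For symmetric matrices $S:M=\sum_{a,b}S_{ab}M_{ab}$; $c_i^tc_i$ is the $2\times2$ matrix with entries $(c_i)_a(c_i)_b$; for a symmetric matrix field $M$, $(\nabla\cdot M)_b=\sum_a\partial_aM_{ab}$. First collision term: $\Omega_i=\frac{1}{\tau(S/h)}\big(f_{iL}(\rho,v)+f_{iQ}(v,v)-f_i\big)$ with $\tau(S)=3\mu(\mathrm{tr}(S^2))+\tfrac12$. Second collision term: $\Omega_i=\frac1\tau\big(f_{iL}(\rho,v)+f_{iQ}(v,v)+w_i\,h\,A(S/h)\,S:c_i^tc_i-f_i\big)$ with constant $\tau>0$ and $A(S)=\tfrac32(\tau-\tfrac12)-\tfrac92\mu(\mathrm{tr}(S^2))$. **Formal expansion.** Since $f_i^{(0)}=w_i$,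 one has $\rho^{(0)}=1$, $v^{(0)}=0$, $S^{(0)}=0$. Let $S_h/h$ denote the formal series $S^{(1)}+hS^{(2)}+h^2S^{(3)}+\cdots$, and define $F^{(n)}$, $A^{(n)}$ as the coefficients of the formal Taylor expansions in $h$: $\tau(S_h/h)\sim\sum_{n\ge0}h^nF^{(n)}$ (first model), $A(S_h/h)\sim\sum_{n\ge0}h^nA^{(n)}$ (second model). Let $$D_{i,s}=\sum_{l+2m=s,\ l,m\ge0}\frac{1}{l!\,m!}\,\partial_t^m(c_i\cdot\nabla)^l\qquad(s\ge1).$$ Solving the lattice Boltzmann equation to all orders means that, after Taylor expansion of the left-hand side and comparison of powers of $h$, for every $k\ge0$ and every $i$: (I) first model: $$\sum_{r+n=k,\ r\ge0,\ n\ge1}F^{(r)}\sum_{s=1}^{n}D_{i,s}f_i^{(n-s)}=-f_i^{(k)}+f_{iL}(\rho^{(k)},v^{(k)})+\sum_{p+q=k}f_{iQ}(v^{(p)},v^{(q)});$$ (II) second model: $$\tau\sum_{s=1}^{k}D_{i,s}f_i^{(k-s)}=-f_i^{(k)}+f_{iL}(\rho^{(k)},v^{(k)})+\sum_{p+q=k}f_{iQ}(v^{(p)},v^{(q)})+\sum_{a+b=k-1,\ a,b\ge0}w_i\,A^{(a)}S^{(b)}:c_i^tc_i$$ (the last summand is written with the indices arising from expanding $h\,A(S_h/h)\,S_h$ where $S_h\sim\sum_{n\ge0}h^nS^{(n)}$; empty sums are $0$). *)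

theory Defs
  imports "HOL-Analysis.Analysis" "HOL-Computational_Algebra.Formal_Power_Series"
begin

section \<open>The D2Q9 lattice\<close>

definition lattice_velocity :: "nat \<Rightarrow> real^2" where
  "lattice_velocity i =
    [vector [0, 0],
     vector [1, 0], vector [0, 1], vector [-1, 0], vector [0, -1],
     vector [1, 1], vector [-1, 1], vector [-1, -1], vector [1, -1]] ! i"

definition weight :: "nat \<Rightarrow> real" where
  "weight i = (if i = 0 then 16/36 else if i \<le> 4 then 4/36 else 1/36)"

section \<open>Calculus of space-time fields\<close>

text \<open>A field is a function of \<open>x \<in> \<real>\<^sup>2\<close> and \<open>t\<close>; only its values for \<open>t \<in> {0..T}\<close> are relevant.
  Time derivatives are taken relative to \<open>{0..T}\<close>, hence are one-sided at the end points.\<close>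

type_synonym 'a field = "real^2 \<Rightarrow> real \<Rightarrow> 'a"

definition dx :: "2 \<Rightarrow> 'a::real_normed_vector field \<Rightarrow> 'a field" where
  "dx a g x t = vector_derivative (\<lambda>s. g (x + s *\<^sub>R axis a 1) t) (at 0)"

definition dt :: "real \<Rightarrow> 'a::real_normed_vector field \<Rightarrow> 'a field" where
  "dt T g x t = vector_derivative (g x) (at t within {0..T})"

text \<open>\<open>u \<cdot> \<nabla>\<close> for a constant vector \<open>u\<close>.\<close>

definition dir_deriv :: "real^2 \<Rightarrow> 'a::real_normed_vector field \<Rightarrow> 'a field" where
  "dir_deriv u g x t = (\<Sum>a\<in>UNIV. (u $ a) *\<^sub>R dx a g x t)"

definition grad :: "real field \<Rightarrow> (real^2) field" where
  "grad g x t = (\<chi> a. dx a g x t)"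

definition vgrad :: "(real^2) field \<Rightarrow> (real^2^2) field" where
  "vgrad v x t = (\<chi> a b. dx a v x t $ b)"

definition divergence :: "(real^2) field \<Rightarrow> real field" where
  "divergence v x t = (\<Sum>a\<in>UNIV. dx a v x t $ a)"

definition mat_divergence :: "(real^2^2) field \<Rightarrow> (real^2) field" where
  "mat_divergence M x t = (\<chi> b. \<Sum>a\<in>UNIV. dx a M x t $ a $ b)"

definition strain :: "(real^2) field \<Rightarrow> (real^2^2) field" where
  "strain v x t = vgrad v x t + transpose (vgrad v x t)"

text \<open>\<open>C\<^sup>\<infinity>\<close> on \<open>\<real>\<^sup>2 \<times> [0,T]\<close>: all iterated partial derivatives exist and are jointly continuous.\<close>

inductive_set iterated_partials :: "real \<Rightarrow> real field \<Rightarrow> real field set"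
  for T :: real and g :: "real field" where
  base: "g \<in> iterated_partials T g"
| space: "h \<in> iterated_partials T g \<Longrightarrow> dx a h \<in> iterated_partials T g"
| time: "h \<in> iterated_partials T g \<Longrightarrow> dt T h \<in> iterated_partials T g"

definition smooth_field :: "real \<Rightarrow> real field \<Rightarrow> bool" where
  "smooth_field T g \<longleftrightarrow>
    (\<forall>h \<in> iterated_partials T g.
       continuous_on (UNIV \<times> {0..T}) (\<lambda>(x, t). h x t) \<and>
       (\<forall>x. \<forall>t\<in>{0..T}.
          (\<forall>a. (\<lambda>s. h (x + s *\<^sub>R axis a 1) t) differentiable (at 0)) \<and>
          h x differentiable (at t within {0..T})))"

text \<open>Periodicity with respect to some full-rank lattice of periods.\<close>

definition spatially_periodic :: "real \<Rightarrow> real field \<Rightarrow> bool" where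
  "spatially_periodic T g \<longleftrightarrow>
    (\<exists>p q. p \<noteq> q \<and> independent {p, q} \<and>
       (\<forall>x. \<forall>t\<in>{0..T}. g (x + p) t = g x t \<and> g (x + q) t = g x t))"

section \<open>Smooth functions on the half-line and formal composition\<close>

definition iterated_deriv_within :: "real set \<Rightarrow> nat \<Rightarrow> (real \<Rightarrow> real) \<Rightarrow> real \<Rightarrow> real" where
  "iterated_deriv_within S k g =
    ((\<lambda>h s. vector_derivative h (at s within S)) ^^ k) g"

definition smooth_on_halfline :: "(real \<Rightarrow> real) \<Rightarrow> bool" where
  "smooth_on_halfline g \<longleftrightarrow> (\<forall>k. iterated_deriv_within {0..} k g differentiable_on {0..})"

text \<open>The formal Taylor expansion of \<open>g(q\<^sub>0 + q\<^sub>1 h + q\<^sub>2 h\<^sup>2 + \<dots>)\<close> in powers of \<open>h\<close>: the Taylor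
  series of \<open>g\<close> at \<open>q\<^sub>0 \<ge> 0\<close>, with the formal series \<open>q\<^sub>1 h + q\<^sub>2 h\<^sup>2 + \<dots>\<close> substituted into it.\<close>

definition formal_expansion :: "(real \<Rightarrow> real) \<Rightarrow> real fps \<Rightarrow> real fps" where
  "formal_expansion g q =
    fps_compose (Abs_fps (\<lambda>k. iterated_deriv_within {0..} k g (fps_nth q 0) / fact k))
                (q - fps_const (fps_nth q 0))"

section \<open>Moments, equilibria and the hierarchies\<close>

text \<open>Below, \<open>f n i\<close> is the coefficient \<open>f\<^sub>i\<^sup>(\<^sup>n\<^sup>)\<close>, and the first two functions
  take the nine populations \<open>f n\<close> of a fixed order.\<close>

definition mass_density :: "(nat \<Rightarrow> real field) \<Rightarrow> real field" where
  "mass_density g x t = (\<Sum>i\<le>8. g i x t)"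

definition momentum :: "(nat \<Rightarrow> real field) \<Rightarrow> (real^2) field" where
  "momentum g x t = (\<Sum>i\<le>8. g i x t *\<^sub>R lattice_velocity i)"

definition equilibrium_L :: "nat \<Rightarrow> real \<Rightarrow> real^2 \<Rightarrow> real" where
  "equilibrium_L i r v = weight i * (r + 3 * (lattice_velocity i \<bullet> v))"

definition equilibrium_Q :: "nat \<Rightarrow> real^2 \<Rightarrow> real^2 \<Rightarrow> real" where
  "equilibrium_Q i u v = weight i *
    (9/2 * (lattice_velocity i \<bullet> u) * (lattice_velocity i \<bullet> v) - 3/2 * (u \<bullet> v))"

definition contraction :: "real^2^2 \<Rightarrow> real^2^2 \<Rightarrow> real" where
  "contraction S M = (\<Sum>a\<in>UNIV. \<Sum>b\<in>UNIV. S $ a $ b * M $ a $ b)"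

definition velocity_outer :: "nat \<Rightarrow> real^2^2" where
  "velocity_outer i = (\<chi> a b. lattice_velocity i $ a * lattice_velocity i $ b)"

text \<open>The operator \<open>D\<^sub>i\<^sub>,\<^sub>s\<close> of the Taylor expansion of \<open>g(x + c\<^sub>i h, t + h\<^sup>2)\<close>.\<close>

definition lattice_taylor :: "real \<Rightarrow> nat \<Rightarrow> nat \<Rightarrow> real field \<Rightarrow> real field" where
  "lattice_taylor T i s g x t =
    (\<Sum>(l, m)\<in>{(l, m). l + 2 * m = s}.
       1 / (fact l * fact m) * (dt T ^^ m) ((dir_deriv (lattice_velocity i) ^^ l) g) x t)"

text \<open>\<open>S\<^sub>h/h = S\<^sup>(\<^sup>1\<^sup>) + h S\<^sup>(\<^sup>2\<^sup>) + h\<^sup>2 S\<^sup>(\<^sup>3\<^sup>) + \<dots>\<close> as a matrix of formal power series; note the index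
  shift, which is legitimate as \<open>S\<^sup>(\<^sup>0\<^sup>) = 0\<close>.\<close>

definition scaled_strain_series ::
    "(nat \<Rightarrow> nat \<Rightarrow> real field) \<Rightarrow> (real fps^2^2) field" where
  "scaled_strain_series f x t =
    (\<chi> a b. Abs_fps (\<lambda>n. strain (momentum (f (Suc n))) x t $ a $ b))"

definition viscosity_series ::
    "(real \<Rightarrow> real) \<Rightarrow> (nat \<Rightarrow> nat \<Rightarrow> real field) \<Rightarrow> real fps field" where
  "viscosity_series \<mu> f x t =
    formal_expansion \<mu> (trace (scaled_strain_series f x t ** scaled_strain_series f x t))"

text \<open>The formal series of \<open>\<tau>(S\<^sub>h/h)\<close> with \<open>\<tau>(S) = 3 \<mu>(tr (S\<^sup>2)) + 1/2\<close>.\<close>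

definition relaxation_series ::
    "(real \<Rightarrow> real) \<Rightarrow> (nat \<Rightarrow> nat \<Rightarrow> real field) \<Rightarrow> real fps field" where
  "relaxation_series \<mu> f x t = fps_const 3 * viscosity_series \<mu> f x t + fps_const (1/2)"

text \<open>The formal series of \<open>A(S\<^sub>h/h)\<close> with \<open>A(S) = 3/2 (\<tau> - 1/2) - 9/2 \<mu>(tr (S\<^sup>2))\<close>.\<close>

definition strain_coupling_series ::
    "(real \<Rightarrow> real) \<Rightarrow> real \<Rightarrow> (nat \<Rightarrow> nat \<Rightarrow> real field) \<Rightarrow> real fps field" where
  "strain_coupling_series \<mu> \<tau> f x t =
    fps_const (3/2 * (\<tau> - 1/2)) - fps_const (9/2) * viscosity_series \<mu> f x t"

text \<open>The order-\<open>k\<close> coefficient of \<open>f\<^sub>i\<^sub>L(\<rho>,v) + f\<^sub>i\<^sub>Q(v,v) - f\<^sub>i\<close>.\<close>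

definition bgk_coeff :: "(nat \<Rightarrow> nat \<Rightarrow> real field) \<Rightarrow> nat \<Rightarrow> nat \<Rightarrow> real field" where
  "bgk_coeff f k i x t =
    - f k i x t
    + equilibrium_L i (mass_density (f k) x t) (momentum (f k) x t)
    + (\<Sum>(p, q)\<in>{(p, q). p + q = k}.
         equilibrium_Q i (momentum (f p) x t) (momentum (f q) x t))"

text \<open>The hierarchy for the relaxation time depending on the strain.\<close>

definition solves_hierarchy_I ::
    "(real \<Rightarrow> real) \<Rightarrow> real \<Rightarrow> (nat \<Rightarrow> nat \<Rightarrow> real field) \<Rightarrow> bool" where
  "solves_hierarchy_I \<mu> T f \<longleftrightarrow>
    (\<forall>k. \<forall>i\<le>8. \<forall>x. \<forall>t\<in>{0..T}.
       (\<Sum>(r, n)\<in>{(r, n). r + n = k \<and> 1 \<le> n}.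
          fps_nth (relaxation_series \<mu> f x t) r *
          (\<Sum>s=1..n. lattice_taylor T i s (f (n - s) i) x t))
       = bgk_coeff f k i x t)"

text \<open>The hierarchy for the constant relaxation time \<open>\<tau>\<close>. The coefficient of \<open>h\<^sup>k\<close> in
  \<open>h A(S\<^sub>h/h) S\<^sub>h\<close> is the sum over \<open>a + b = k - 1\<close>, which is empty for \<open>k = 0\<close>.\<close>

definition solves_hierarchy_II ::
    "(real \<Rightarrow> real) \<Rightarrow> real \<Rightarrow> real \<Rightarrow> (nat \<Rightarrow> nat \<Rightarrow> real field) \<Rightarrow> bool" where
  "solves_hierarchy_II \<mu> \<tau> T f \<longleftrightarrow>
    (\<forall>k. \<forall>i\<le>8. \<forall>x. \<forall>t\<in>{0..T}.
       \<tau> * (\<Sum>s=1..k. lattice_taylor T i s (f (k - s) i) x t)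
       = bgk_coeff f k i x t
         + (\<Sum>(a, b)\<in>{(a, b). a + b + 1 = k}.
              weight i * fps_nth (strain_coupling_series \<mu> \<tau> f x t) a *
              contraction (strain (momentum (f b)) x t) (velocity_outer i)))"

end

theory Submission
  imports Defs
begin

text \<open>Order 1 says that \<open>f\<^sup>(\<^sup>1\<^sup>)\<close> is the linear equilibrium of \<open>\<rho>\<^sup>(\<^sup>1\<^sup>)\<close> and \<open>v\<^sup>(\<^sup>1\<^sup>)\<close>. The conserved moments of
  order 2 give \<open>\<nabla> \<cdot> v\<^sup>(\<^sup>1\<^sup>) = 0\<close> and \<open>\<nabla>\<rho>\<^sup>(\<^sup>1\<^sup>) = 0\<close>, its second moments give the momentum flux
  \<open>\<rho>\<^sup>(\<^sup>2\<^sup>)/3 + v\<^sup>(\<^sup>1\<^sup>) v\<^sup>(\<^sup>1\<^sup>) - (\<mu> + 1/6) S\<^sup>(\<^sup>1\<^sup>)\<close>. The mass balance of order 3 makes \<open>\<nabla> \<cdot> v\<^sup>(\<^sup>2\<^sup>)\<close> a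
  multiple, bounded away from zero, of \<open>\<partial>\<^sub>t \<rho>\<^sup>(\<^sup>1\<^sup>)\<close>; as \<open>v\<^sup>(\<^sup>2\<^sup>)\<close> is bounded, \<open>\<partial>\<^sub>t \<rho>\<^sup>(\<^sup>1\<^sup>) = 0\<close>. The
  momentum balance of order 3 is the Navier-Stokes equation: the second-order Taylor term
  \<open>(c\<^sub>i \<cdot> \<nabla>)\<^sup>2/2\<close> cancels the excess viscosity \<open>1/6\<close>. Up to \<open>\<nabla>(\<nabla> \<cdot> v\<^sup>(\<^sup>1\<^sup>)) = 0\<close>, mixed derivatives occur in
  both with the same order of differentiation, so no symmetry of second derivatives is needed.\<close>

section \<open>Velocity moments\<close>

lemma sum_le_8: "(\<Sum>i\<le>8. g i) = g 0 + g 1 + g 2 + g 3 + g 4 + g 5 + g 6 + g 7 + g (8::nat)"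
  for g :: "nat \<Rightarrow> 'a::comm_monoid_add"
  by (simp add: numeral_eq_Suc atMost_Suc add_ac)

lemma lattice_velocity_nth:
  "lattice_velocity 0 $ 1 = 0" "lattice_velocity 0 $ 2 = 0"
  "lattice_velocity (Suc 0) $ 1 = 1" "lattice_velocity (Suc 0) $ 2 = 0"
  "lattice_velocity 2 $ 1 = 0" "lattice_velocity 2 $ 2 = 1"
  "lattice_velocity 3 $ 1 = -1" "lattice_velocity 3 $ 2 = 0"
  "lattice_velocity 4 $ 1 = 0" "lattice_velocity 4 $ 2 = -1"
  "lattice_velocity 5 $ 1 = 1" "lattice_velocity 5 $ 2 = 1"
  "lattice_velocity 6 $ 1 = -1" "lattice_velocity 6 $ 2 = 1"
  "lattice_velocity 7 $ 1 = -1" "lattice_velocity 7 $ 2 = -1"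
  "lattice_velocity 8 $ 1 = 1" "lattice_velocity 8 $ 2 = -1"
  by (simp_all add: lattice_velocity_def vector_2 nth_Cons_numeral)

lemmas d2q9_simps = sum_le_8 lattice_velocity_nth weight_def sum_2 inner_vec_def
  equilibrium_L_def equilibrium_Q_def contraction_def velocity_outer_def

text \<open>The moments of the D2Q9 weights are isotropic up to order four: the sums of
  \<open>w\<close>, \<open>w c_a c_b\<close> and \<open>w c_a c_b c_d c_e\<close> are 1,
  \<open>delta_ab / 3\<close> and \<open>(delta_ab delta_de + delta_ad delta_be + delta_ae delta_bd)
  / 9\<close>, and odd moments vanish. This and the next four lemmas are instances, checked
  component by component.\<close>

lemma equilibrium_L_moments:
  "(\<Sum>i\<le>8. equilibrium_L i r u) = r"
  "(\<Sum>i\<le>8. equilibrium_L i r u * lattice_velocity i $ a) = u $ a"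
  "(\<Sum>i\<le>8. equilibrium_L i r u * lattice_velocity i $ a * lattice_velocity i $ b)
     = (if a = b then r / 3 else 0)"
  using exhaust_2[of a] exhaust_2[of b] by (auto simp: d2q9_simps field_simps)

text \<open>The trace part that the fourth moment produces from the factor 9/2 is cancelled by the
  term with 3/2, which leaves exactly the convective flux \<open>u u\<close>.\<close>

lemma equilibrium_Q_moments:
  "(\<Sum>i\<le>8. equilibrium_Q i u v) = 0"
  "(\<Sum>i\<le>8. equilibrium_Q i u v * lattice_velocity i $ a) = 0"
  "(\<Sum>i\<le>8. equilibrium_Q i u u * lattice_velocity i $ a * lattice_velocity i $ b) = u $ a * u $ b"
  using exhaust_2[of a] exhaust_2[of b] by (auto simp: d2q9_simps field_simps)

lemma contraction_moments:
  "(\<Sum>i\<le>8. weight i * contraction M (velocity_outer i)) = (\<Sum>a\<in>UNIV. M $ a $ a) / 3"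
  "(\<Sum>i\<le>8. weight i * contraction M (velocity_outer i) * lattice_velocity i $ a) = 0"
  "(\<Sum>i\<le>8. weight i * contraction M (velocity_outer i) * lattice_velocity i $ a * lattice_velocity i $ b)
     = (M $ a $ b + M $ b $ a + (if a = b then \<Sum>c\<in>UNIV. M $ c $ c else 0)) / 9"
  using exhaust_2[of a] exhaust_2[of b] by (auto simp: d2q9_simps field_simps)

text \<open>\<open>R a\<close> and \<open>U a\<close> stand for the partial derivatives of density
  and velocity, so that \<open>g\<close> becomes the directional derivative along \<open>c_i\<close>
  of a linear equilibrium. Keeping them as arbitrary values makes the claim purely
  algebraic.\<close>

lemma advected_equilibrium_moments:
  fixes R :: "2 \<Rightarrow> real" and U :: "2 \<Rightarrow> real^2"
  defines "g \<equiv> \<lambda>i. \<Sum>a\<in>UNIV. lattice_velocity i $ a * equilibrium_L i (R a) (U a)"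
  shows "(\<Sum>i\<le>8. g i) = (\<Sum>a\<in>UNIV. U a $ a)"
    and "(\<Sum>i\<le>8. g i * lattice_velocity i $ a) = R a / 3"
    and "(\<Sum>i\<le>8. g i * lattice_velocity i $ a * lattice_velocity i $ b)
      = (U a $ b + U b $ a + (if a = b then \<Sum>c\<in>UNIV. U c $ c else 0)) / 3"
  unfolding g_def using exhaust_2[of a] exhaust_2[of b] by (auto simp: d2q9_simps field_simps)

text \<open>The analogue for \<open>(c_i . grad)^2\<close>: \<open>R a b\<close> and
  \<open>U a b\<close> stand for \<open>dx a (dx b _)\<close>, with the order of differentiation
  recorded by the order of the indices.\<close>

lemma twice_advected_equilibrium_moments:
  fixes R :: "2 \<Rightarrow> 2 \<Rightarrow> real" and U :: "2 \<Rightarrow> 2 \<Rightarrow> real^2"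
  defines "g \<equiv> \<lambda>i. \<Sum>a\<in>UNIV. \<Sum>b\<in>UNIV.
    lattice_velocity i $ a * lattice_velocity i $ b * equilibrium_L i (R a b) (U a b)"
  shows "(\<Sum>i\<le>8. g i) = (\<Sum>a\<in>UNIV. R a a) / 3"
    and "(\<Sum>i\<le>8. g i * lattice_velocity i $ a)
      = (\<Sum>b\<in>UNIV. U b b $ a + U a b $ b + U b a $ b) / 3"
  unfolding g_def using exhaust_2[of a] by (auto simp: d2q9_simps field_simps)

text \<open>The linear equilibrium has the same mass and momentum as the populations of its order,
  and the quadratic one has neither. Hence relaxation conserves both at every order.\<close>

lemma bgk_conserves:
  "(\<Sum>i\<le>8. bgk_coeff f k i x t) = 0"
  "(\<Sum>i\<le>8. bgk_coeff f k i x t * lattice_velocity i $ a) = 0"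
proof -
  have "(\<Sum>i\<le>8. \<Sum>(p, q)\<in>{(p, q). p + q = k}. equilibrium_Q i (momentum (f p) x t) (momentum (f q) x t))
      = (\<Sum>(p, q)\<in>{(p, q). p + q = k}. \<Sum>i\<le>8. equilibrium_Q i (momentum (f p) x t) (momentum (f q) x t))"
    unfolding case_prod_beta by (rule sum.swap)
  then show "(\<Sum>i\<le>8. bgk_coeff f k i x t) = 0"
    by (simp add: bgk_coeff_def sum.distrib sum_subtractf equilibrium_L_moments
        equilibrium_Q_moments mass_density_def case_prod_beta)
  have "(\<Sum>i\<le>8. (\<Sum>(p, q)\<in>{(p, q). p + q = k}.
          equilibrium_Q i (momentum (f p) x t) (momentum (f q) x t)) * lattice_velocity i $ a)
      = (\<Sum>(p, q)\<in>{(p, q). p + q = k}. \<Sum>i\<le>8.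
          equilibrium_Q i (momentum (f p) x t) (momentum (f q) x t) * lattice_velocity i $ a)"
    unfolding case_prod_beta sum_distrib_right by (rule sum.swap)
  then show "(\<Sum>i\<le>8. bgk_coeff f k i x t * lattice_velocity i $ a) = 0"
    by (simp add: bgk_coeff_def ring_distribs sum.distrib sum_subtractf equilibrium_L_moments
        equilibrium_Q_moments momentum_def case_prod_beta sum_negf)
qed

section \<open>Calculus of fields\<close>

lemma dx_eqI:
  "((\<lambda>s. g (x + s *\<^sub>R axis a 1) t) has_vector_derivative D) (at 0) \<Longrightarrow> dx a g x t = D"
  unfolding dx_def by (rule vector_derivative_at)

lemma dx_works:
  "(\<lambda>s. g (x + s *\<^sub>R axis a 1) t) differentiable (at 0) \<Longrightarrow>
    ((\<lambda>s. g (x + s *\<^sub>R axis a 1) t) has_vector_derivative dx a g x t) (at 0)"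
  unfolding dx_def by (simp add: vector_derivative_works)

lemma dx_cong: "(\<And>y. g y t = h y t) \<Longrightarrow> dx a g x t = dx a h x t"
  by (simp add: dx_def)

lemma dx_const [simp]: "dx a (\<lambda>y s. k s) x t = 0"
  by (rule dx_eqI) (auto intro!: derivative_eq_intros)

text \<open>Since \<open>0 < T\<close>, the interval is nondegenerate, so derivatives relative to it
  are unique even at its end points.\<close>

lemma dt_eqI:
  assumes "0 < T" "t \<in> {0..T}" "(g x has_vector_derivative D) (at t within {0..T})"
  shows "dt T g x t = D"
  unfolding dt_def using assms vector_derivative_within_cbox[of 0 T t "g x" D] by simp

lemma dt_cong:
  assumes "\<And>s. s \<in> {0..T} \<Longrightarrow> g x s = h y s" "t \<in> {0..T}"
  shows "dt T g x t = dt T h y t"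
  unfolding dt_def using assms by (intro vector_derivative_cong_eq) auto

lemma dt_const: "0 < T \<Longrightarrow> t \<in> {0..T} \<Longrightarrow> dt T (\<lambda>y s. k y) x t = 0"
  by (rule dt_eqI) (auto intro!: derivative_eq_intros)

lemma iterated_partials_trans:
  "h \<in> iterated_partials T k \<Longrightarrow> k \<in> iterated_partials T g \<Longrightarrow> h \<in> iterated_partials T g"
  by (induction rule: iterated_partials.induct) (auto intro: iterated_partials.intros)

lemma smooth_field_dx: "smooth_field T g \<Longrightarrow> smooth_field T (dx a g)"
  unfolding smooth_field_def
  by (meson iterated_partials.base iterated_partials.space iterated_partials_trans)

lemma smooth_field_continuous:
  "smooth_field T g \<Longrightarrow> continuous_on (UNIV \<times> {0..T}) (\<lambda>(x, t). g x t)"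
  using iterated_partials.base[of g T] by (auto simp: smooth_field_def)

lemma smooth_field_continuous_slice:
  assumes "smooth_field T g" "t \<in> {0..T}"
  shows "continuous_on UNIV (\<lambda>x. g x t)"
  by (rule continuous_on_compose2[OF smooth_field_continuous[OF assms(1)],
        where f = "\<lambda>x. (x, t)", simplified])
     (use assms(2) in \<open>auto intro!: continuous_intros\<close>)

lemma smooth_field_has_dx:
  assumes "smooth_field T g" "t \<in> {0..T}"
  shows "((\<lambda>s. g (x + s *\<^sub>R axis a 1) t) has_vector_derivative dx a g x t) (at 0)"
  using assms iterated_partials.base[of g T] by (intro dx_works) (auto simp: smooth_field_def)

lemma smooth_field_has_dt:
  assumes "smooth_field T g" "t \<in> {0..T}"
  shows "(g x has_vector_derivative dt T g x t) (at t within {0..T})"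
  using assms iterated_partials.base[of g T]
  by (auto simp: dt_def vector_derivative_works[symmetric] smooth_field_def)

lemma has_dx_sum_scaleR:
  assumes "\<And>j. j \<in> J \<Longrightarrow> smooth_field T (g j)" "t \<in> {0..T}"
  shows "((\<lambda>s. \<Sum>j\<in>J. g j (x + s *\<^sub>R axis a 1) t *\<^sub>R k j)
    has_vector_derivative (\<Sum>j\<in>J. dx a (g j) x t *\<^sub>R k j)) (at 0)"
  by (rule has_vector_derivative_sum,
      rule bounded_linear.has_vector_derivative[OF bounded_linear_scaleR_left],
      rule smooth_field_has_dx, use assms in auto)

lemma dx_sum_scaleR:
  assumes "\<And>j. j \<in> J \<Longrightarrow> smooth_field T (g j)" "t \<in> {0..T}"
  shows "dx a (\<lambda>y s. \<Sum>j\<in>J. g j y s *\<^sub>R k j) x t = (\<Sum>j\<in>J. dx a (g j) x t *\<^sub>R k j)"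
  by (rule dx_eqI, rule has_dx_sum_scaleR[OF assms(1)]) (use assms(2) in auto)

lemma has_dt_sum_scaleR:
  assumes "\<And>j. j \<in> J \<Longrightarrow> smooth_field T (g j)" "t \<in> {0..T}"
  shows "((\<lambda>s. \<Sum>j\<in>J. g j x s *\<^sub>R k j)
    has_vector_derivative (\<Sum>j\<in>J. dt T (g j) x t *\<^sub>R k j)) (at t within {0..T})"
  by (rule has_vector_derivative_sum,
      rule bounded_linear.has_vector_derivative[OF bounded_linear_scaleR_left],
      rule smooth_field_has_dt, use assms in auto)

lemma dir_deriv_twice:
  assumes "smooth_field T g" "t \<in> {0..T}"
  shows "dir_deriv u (dir_deriv u g) x t
    = (\<Sum>a\<in>UNIV. \<Sum>b\<in>UNIV. u $ a * u $ b * dx a (dx b g) x t)"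
proof -
  have "dx a (dir_deriv u g) x t = (\<Sum>b\<in>UNIV. dx a (dx b g) x t *\<^sub>R u $ b)" for a
    using dx_sum_scaleR[of UNIV T "\<lambda>b. dx b g" t a "\<lambda>b. u $ b" x] assms smooth_field_dx
    by (simp add: dir_deriv_def[abs_def] mult_ac)
  then show ?thesis
    by (simp add: dir_deriv_def sum_distrib_left mult_ac)
qed

subsection \<open>The operators \<open>D\<^sub>i\<^sub>,\<^sub>s\<close>\<close>

lemma lattice_taylor_1: "lattice_taylor T i 1 g x t = dir_deriv (lattice_velocity i) g x t"
proof -
  have "{(l, m). l + 2 * m = (1::nat)} = {(1, 0)}" by (auto; presburger)
  then show ?thesis by (simp add: lattice_taylor_def)
qed

lemma lattice_taylor_2:
  "lattice_taylor T i 2 g x t =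
    dir_deriv (lattice_velocity i) (dir_deriv (lattice_velocity i) g) x t / 2 + dt T g x t"
proof -
  have "{(l, m). l + 2 * m = (2::nat)} = {(2, 0), (0, 1)}" by (auto; presburger)
  then show ?thesis by (simp add: lattice_taylor_def numeral_2_eq_2)
qed

text \<open>For \<open>n \<ge> 1\<close> each summand contains at least one derivative. As
  \<open>g\<close> is controlled only for times in \<open>{0..T}\<close>, both inductions carry that
  restriction. Applied to \<open>f 0\<close>, this removes the order-0 populations from the
  hierarchies.\<close>

lemma lattice_taylor_const:
  assumes "0 < T" and g: "\<And>y s. s \<in> {0..T} \<Longrightarrow> g y s = k" and "1 \<le> n" "t \<in> {0..T}"
  shows "lattice_taylor T i n g x t = 0"
proof -
  let ?D = "dir_deriv (lattice_velocity i)"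
  have dir: "\<forall>y. \<forall>s\<in>{0..T}. (?D ^^ l) g y s = (if l = 0 then k else 0)" for l
  proof (induction l)
    case (Suc l)
    then have "dx a ((?D ^^ l) g) y s = 0" if "s \<in> {0..T}" for a y s
      using that dx_cong[of "(?D ^^ l) g" s "\<lambda>_ _. if l = 0 then k else 0" a y] by auto
    then show ?case by (simp add: dir_deriv_def[of _ "(?D ^^ l) g"])
  qed (use g in simp)
  have "\<forall>y. \<forall>s\<in>{0..T}. (dt T ^^ m) ((?D ^^ l) g) y s = (if l = 0 \<and> m = 0 then k else 0)" for l m
  proof (induction m)
    case (Suc m)
    then have "dt T ((dt T ^^ m) ((?D ^^ l) g)) y s = 0" if "s \<in> {0..T}" for y s
      using that dt_cong[of T "(dt T ^^ m) ((?D ^^ l) g)" y "\<lambda>_ _. if l = 0 \<and> m = 0 then k else 0" y s]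
        dt_const[OF \<open>0 < T\<close>, of s "\<lambda>_. if l = 0 \<and> m = 0 then k else 0" y] by (simp del: if_split)
    then show ?case by simp
  qed (use dir in simp)
  then show ?thesis
    unfolding lattice_taylor_def using assms(3,4) by (intro sum.neutral) auto
qed

section \<open>Bounded fields on the plane\<close>

text \<open>Two independent periods span the plane, so integer translations move every point into
  the parallelogram \<open>K\<close>, which is compact.\<close>

lemma continuous_doubly_periodic_bounded:
  fixes g :: "real^2 \<Rightarrow> real"
  assumes cont: "continuous_on UNIV g" and pq: "p \<noteq> q" "independent {p, q}"
    and per: "\<And>x. g (x + p) = g x" "\<And>x. g (x + q) = g x"
  obtains M where "\<And>x. \<bar>g x\<bar> \<le> M"
proof -
  have int_per: "g (x + of_int m *\<^sub>R r) = g x" if r: "\<And>x. g (x + r) = g x" for x r m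
  proof (induction m rule: int_induct[of _ 0])
    case (step1 i)
    then show ?case using r[of "x + of_int i *\<^sub>R r"] by (simp add: algebra_simps)
  next
    case (step2 i)
    then show ?case using r[of "x + of_int (i - 1) *\<^sub>R r"] by (simp add: algebra_simps)
  qed simp
  define K where "K = (\<lambda>(a, b). a *\<^sub>R p + b *\<^sub>R q) ` ({0..1::real} \<times> {0..1::real})"
  have "compact K"
    unfolding K_def case_prod_beta
    by (intro compact_continuous_image compact_Times compact_Icc continuous_intros)
  then have "compact (g ` K)"
    by (rule compact_continuous_image[rotated]) (use cont continuous_on_subset in blast)
  then obtain M where M: "\<And>y. y \<in> g ` K \<Longrightarrow> \<bar>y\<bar> \<le> M"
    using compact_imp_bounded bounded_real by metis
  have span: "span {p, q} = UNIV"
    using pq card_eq_dim[of "{p, q}" UNIV] by (auto simp: dim_UNIV)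
  have "\<bar>g x\<bar> \<le> M" for x
  proof -
    obtain a b where x: "x = a *\<^sub>R p + b *\<^sub>R q"
    proof -
      obtain a where "x - a *\<^sub>R p \<in> span {q}"
        using span span_breakdown_eq[of x p "{q}"] by blast
      then obtain b where "x - a *\<^sub>R p = b *\<^sub>R q"
        by (auto simp: span_singleton)
      then show thesis using that[of a b] by (simp add: algebra_simps)
    qed
    have "g x = g (frac a *\<^sub>R p + frac b *\<^sub>R q + of_int \<lfloor>a\<rfloor> *\<^sub>R p + of_int \<lfloor>b\<rfloor> *\<^sub>R q)"
      by (simp add: x frac_def algebra_simps)
    also have "\<dots> = g (frac a *\<^sub>R p + frac b *\<^sub>R q)"
      by (simp only: int_per per)
    finally show ?thesis
      using M[of "g x"] by (force simp: K_def frac_lt_1 less_imp_le)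
  qed
  then show thesis using that by blast
qed

lemma spatially_periodic_dx:
  assumes "spatially_periodic T g"
  shows "spatially_periodic T (dx a g)"
proof -
  have "dx a g (x + r) t = dx a g x t" if "\<And>x. g (x + r) t = g x t" for x r t
    using that[of "x + s *\<^sub>R axis a 1" for s] by (simp add: dx_def add_ac)
  then show ?thesis
    using assms unfolding spatially_periodic_def by metis
qed

lemma smooth_periodic_bounded:
  assumes "smooth_field T g" "spatially_periodic T g" "t \<in> {0..T}"
  obtains M where "\<And>x. \<bar>g x t\<bar> \<le> M"
proof -
  obtain p q where "p \<noteq> q" "independent {p, q}"
      "\<And>x. g (x + p) t = g x t" "\<And>x. g (x + q) t = g x t"
    using assms(2,3) unfolding spatially_periodic_def by blast
  then show thesis
    using continuous_doubly_periodic_bounded[OF smooth_field_continuous_slice[OF assms(1,3)]] that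
    by metis
qed

text \<open>\<open>dx\<close> differentiates at parameter 0 from a moving base point. This turns
  such information into a derivative at every parameter of one fixed line.\<close>

lemma has_vector_derivative_translate:
  fixes g :: "real \<Rightarrow> real"
  assumes "((\<lambda>s. g (r + s)) has_vector_derivative D) (at 0)"
  shows "(g has_vector_derivative D) (at r)"
  using assms DERIV_shift[of g D 0 r]
  by (simp add: has_real_derivative_iff_has_vector_derivative[symmetric] add.commute)

text \<open>The flux through the boundary of a square of side \<open>R\<close> is \<open>O(R)\<close>, whereas a divergence bounded
  below by \<open>\<kappa> > 0\<close> forces it to be at least \<open>\<kappa> R\<^sup>2\<close>.\<close>

lemma bounded_field_divergence_not_positive:
  fixes u1 u2 d1 d2 :: "real^2 \<Rightarrow> real"
  assumes d1: "\<And>x. ((\<lambda>s. u1 (x + s *\<^sub>R axis 1 1)) has_vector_derivative d1 x) (at 0)"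
    and d2: "\<And>x. ((\<lambda>s. u2 (x + s *\<^sub>R axis 2 1)) has_vector_derivative d2 x) (at 0)"
    and cont: "continuous_on UNIV u2" "continuous_on UNIV d1" "continuous_on UNIV d2"
    and bounds: "\<And>x. \<bar>u1 x\<bar> \<le> M" "\<And>x. \<bar>u2 x\<bar> \<le> M"
    and "0 < \<kappa>" and div: "\<And>x. \<kappa> \<le> d1 x + d2 x"
  shows False
proof -
  define e where "e x y = (vector [x, y] :: real^2)" for x y
  have e_eq: "e x y = x *\<^sub>R axis 1 1 + y *\<^sub>R axis 2 1" for x y
    by (simp add: e_def vec_eq_iff forall_2 vector_2 axis_def)
  have e_cont: "continuous_on S (\<lambda>z. g (e (a z) (b z)))"
    if "continuous_on UNIV g" "continuous_on S a" "continuous_on S b"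
    for g :: "real^2 \<Rightarrow> real" and S :: "'z::topological_space set" and a b
    by (rule continuous_on_compose2[OF that(1)])
       (auto simp: e_eq intro!: continuous_intros that)
  have e1: "((\<lambda>x. u1 (e x y)) has_vector_derivative d1 (e x y)) (at x)" for x y
    by (rule has_vector_derivative_translate) (use d1[of "e x y"] in \<open>simp add: e_eq algebra_simps\<close>)
  have e2: "((\<lambda>y. u2 (e x y)) has_vector_derivative d2 (e x y)) (at y)" for x y
    by (rule has_vector_derivative_translate) (use d2[of "e x y"] in \<open>simp add: e_eq algebra_simps\<close>)
  have "0 \<le> M" using bounds(1)[of 0] by simp
  \<comment> \<open>With this side length \<open>\<kappa> * R = 4 * M + \<kappa>\<close>, just above
    the bound \<open>4 * M\<close> reached at the end.\<close>
  define R where "R = 4 * M / \<kappa> + 1"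
  have "0 < R" using \<open>0 \<le> M\<close> \<open>0 < \<kappa>\<close> by (simp add: R_def add_nonneg_pos)
  \<comment> \<open>\<open>\<phi> y\<close> is the flux of \<open>u2\<close> through the horizontal
    segment of length \<open>R\<close> at height \<open>y\<close>.\<close>
  define \<phi> where "\<phi> y = integral (cbox 0 R) (\<lambda>x. u2 (e x y))" for y
  have int: "(\<lambda>x. u2 (e x y)) integrable_on cbox 0 R" "(\<lambda>x. d2 (e x y)) integrable_on cbox 0 R" for y
    by (rule integrable_continuous, rule e_cont[OF _ continuous_on_id continuous_on_const],
        rule cont)+
  have \<phi>': "(\<phi> has_vector_derivative integral (cbox 0 R) (\<lambda>x. d2 (e x y))) (at y)" for y
    unfolding \<phi>_def
  proof (rule leibniz_rule_vector_derivative[where U = UNIV])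
    show "continuous_on (UNIV \<times> cbox 0 R) (\<lambda>(y, x). d2 (e x y))"
      unfolding case_prod_beta
      by (rule e_cont[OF cont(3) continuous_on_snd[OF continuous_on_id] continuous_on_fst[OF continuous_on_id]])
  qed (use e2 int in simp_all)
  \<comment> \<open>On a segment the divergence integrates to at least \<open>\<kappa> * R\<close>.
    The part coming from \<open>d1\<close> is a difference of two boundary values of
    \<open>u1\<close>, hence at most \<open>2 * M\<close>, and \<open>d2\<close> has to supply the
    rest.\<close>
  have \<phi>'_ge: "\<kappa> * R - 2 * M \<le> integral (cbox 0 R) (\<lambda>x. d2 (e x y))" for y
  proof -
    have "((\<lambda>x. d1 (e x y)) has_integral u1 (e R y) - u1 (e 0 y)) {0..R}"
      using \<open>0 < R\<close> by (intro fundamental_theorem_of_calculus has_vector_derivative_at_within[OF e1]) auto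
    from has_integral_add[OF this integrable_integral[OF int(2)[of y], unfolded cbox_interval]]
    have sum: "((\<lambda>x. d1 (e x y) + d2 (e x y)) has_integral
        u1 (e R y) - u1 (e 0 y) + integral {0..R} (\<lambda>x. d2 (e x y))) {0..R}" .
    have "((\<lambda>x. \<kappa>) has_integral \<kappa> * R) {0..R}"
      using has_integral_const_real[of \<kappa> 0 R] \<open>0 < R\<close> by (simp add: mult.commute)
    then have "\<kappa> * R \<le> u1 (e R y) - u1 (e 0 y) + integral {0..R} (\<lambda>x. d2 (e x y))"
      by (rule has_integral_le[OF _ sum div])
    then show ?thesis
      using bounds(1)[of "e R y"] bounds(1)[of "e 0 y"] by simp
  qed
  have \<phi>_le: "\<bar>\<phi> y\<bar> \<le> M * R" for y
    using has_integral_bound[OF \<open>0 \<le> M\<close> integrable_integral[OF int(1)[of y]]] bounds(2) \<open>0 < R\<close>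
    by (simp add: \<phi>_def)
  \<comment> \<open>The mean value theorem in \<open>y\<close> takes the place of a double integral
    over the square.\<close>
  obtain z where "\<phi> R - \<phi> 0 = (R - 0) * integral (cbox 0 R) (\<lambda>x. d2 (e x z))"
    using MVT2[OF \<open>0 < R\<close>, of \<phi> "\<lambda>y. integral (cbox 0 R) (\<lambda>x. d2 (e x y))"] \<phi>'
    by (auto simp: has_real_derivative_iff_has_vector_derivative)
  then have "R * (\<kappa> * R - 2 * M) \<le> \<phi> R - \<phi> 0"
    using \<phi>'_ge[of z] \<open>0 < R\<close> by simp
  also have "\<dots> \<le> R * (2 * M)"
    using \<phi>_le[of R] \<phi>_le[of 0] by (simp add: abs_le_iff algebra_simps)
  finally have "\<kappa> * R \<le> 4 * M"
    using \<open>0 < R\<close> by simp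
  moreover have "\<kappa> * R = 4 * M + \<kappa>"
    using \<open>0 < \<kappa>\<close> by (simp add: R_def distrib_left)
  ultimately show False
    using \<open>0 < \<kappa>\<close> by simp
qed

section \<open>The viscosity\<close>

lemma smooth_on_halfline_differentiable:
  "smooth_on_halfline \<mu> \<Longrightarrow> \<mu> differentiable_on {0..}"
  by (auto simp: smooth_on_halfline_def iterated_deriv_within_def dest: spec[of _ 0])

text \<open>At 0 the function \<open>\<mu>\<close> has only a one-sided derivative. The chain rule
  relative to the range of \<open>q\<close>, which lies in the half-line, covers the points where
  \<open>q\<close> vanishes.\<close>

lemma differentiable_viscosity_compose:
  fixes q :: "real \<Rightarrow> real"
  assumes "smooth_on_halfline \<mu>" "\<And>s. 0 \<le> q s" "q differentiable (at r)"
  shows "(\<lambda>s. \<mu> (q s)) differentiable (at r)"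
proof -
  have "\<mu> differentiable (at (q r) within range q)"
    using smooth_on_halfline_differentiable[OF assms(1)] assms(2)
    by (auto simp: differentiable_on_def intro: differentiable_within_subset)
  then show ?thesis
    using differentiable_chain_within[of q r UNIV \<mu>] assms(3) by (simp add: o_def)
qed

text \<open>The constant coefficient of a composition is that of the outer series, here
  \<open>\<mu>\<close> at the constant term of the trace. The index shift in
  \<open>scaled_strain_series\<close> makes this term the one built from order 1.\<close>

lemma viscosity_series_nth_0:
  "fps_nth (viscosity_series \<mu> f x t) 0
    = \<mu> (trace (strain (momentum (f 1)) x t ** strain (momentum (f 1)) x t))"
  by (simp add: viscosity_series_def formal_expansion_def iterated_deriv_within_def trace_def
      matrix_matrix_mult_def scaled_strain_series_def fps_sum_nth)

section \<open>Moments of smooth populations\<close>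

text \<open>Each \<open>g j\<close> may have its own lattice of periods, so the sum need not be
  periodic; boundedness is the property that survives summation.\<close>

lemma bounded_sum_scaleR:
  assumes "finite J" "\<And>j. j \<in> J \<Longrightarrow> smooth_field T (g j) \<and> spatially_periodic T (g j)"
    and "t \<in> {0..T}"
  obtains B where "\<And>x. norm (\<Sum>j\<in>J. g j x t *\<^sub>R k j) \<le> B"
proof -
  have "\<forall>j\<in>J. \<exists>M. \<forall>x. \<bar>g j x t\<bar> \<le> M"
    using smooth_periodic_bounded assms(2,3) by metis
  then obtain M where M: "\<And>j x. j \<in> J \<Longrightarrow> \<bar>g j x t\<bar> \<le> M j"
    by metis
  have "norm (\<Sum>j\<in>J. g j x t *\<^sub>R k j) \<le> (\<Sum>j\<in>J. M j * norm (k j))" for x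
    by (rule sum_norm_le) (auto intro: mult_right_mono M)
  then show thesis using that by blast
qed

text \<open>The function is constant on every line parallel to an axis, and two such lines connect
  any point with the origin.\<close>

lemma dx_zero_imp_constant:
  fixes g :: "real^2 \<Rightarrow> real"
  assumes "\<And>a x. ((\<lambda>s. g (x + s *\<^sub>R axis a 1)) has_vector_derivative 0) (at 0)"
  shows "g x = g y"
proof -
  have line: "g (x + r *\<^sub>R axis a 1) = g x" for x a and r :: real
  proof -
    have "((\<lambda>s. g (x + s *\<^sub>R axis a 1)) has_vector_derivative 0) (at r)" for r
      by (rule has_vector_derivative_translate)
         (use assms[of "x + r *\<^sub>R axis a 1" a] in \<open>simp add: algebra_simps\<close>)
    then obtain c where "\<And>s. g (x + s *\<^sub>R axis a 1) = c"
      using has_vector_derivative_zero_constant[of UNIV "\<lambda>s. g (x + s *\<^sub>R axis a 1)"] by auto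
    from this[of r] this[of 0] show ?thesis by simp
  qed
  have "x = 0 + x $ 1 *\<^sub>R axis 1 1 + x $ 2 *\<^sub>R axis 2 1" for x :: "real^2"
    by (simp add: vec_eq_iff forall_2 axis_def)
  then have "g x = g 0" for x
    using line by metis
  then show ?thesis by metis
qed

lemma momentum_nth: "momentum g x t $ a = (\<Sum>i\<le>8. g i x t * lattice_velocity i $ a)"
  by (simp add: momentum_def)

lemma strain_nth: "strain u x t $ a $ b = dx a u x t $ b + dx b u x t $ a"
  by (simp add: strain_def vgrad_def transpose_def)

lemma strain_symmetric: "strain u x t $ a $ b = strain u x t $ b $ a"
  by (simp add: strain_nth)

lemma strain_diagonal: "(\<Sum>a\<in>UNIV. strain u x t $ a $ a) = 2 * divergence u x t"
  by (simp add: strain_nth divergence_def sum_distrib_left)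

lemma trace_strain_square:
  "trace (strain u x t ** strain u x t) = (\<Sum>a\<in>UNIV. \<Sum>b\<in>UNIV. (strain u x t $ a $ b)\<^sup>2)"
  by (simp add: trace_def matrix_matrix_mult_def strain_nth power2_eq_square add.commute)

text \<open>For \<open>p = (i, d)\<close> this is the symmetrised dyad of the basis vector
  \<open>e_d\<close> and \<open>c_i\<close>, the coefficient of \<open>dx d (g i)\<close> in the
  strain of the momentum. It makes the strain a finite linear combination of smooth scalar fields
  with constant matrices.\<close>

definition strain_dyad :: "nat \<times> 2 \<Rightarrow> real^2^2" where
  "strain_dyad p = (\<chi> a b. (if a = snd p then lattice_velocity (fst p) $ b else 0)
    + (if b = snd p then lattice_velocity (fst p) $ a else 0))"

text \<open>Smoothness passes to partial derivatives, so the locale applies both to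
  \<open>f n\<close> and to its spatial derivatives; second derivatives of moments come from using
  it twice.\<close>

locale smooth_populations =
  fixes T :: real and g :: "nat \<Rightarrow> real field"
  assumes T_pos: "0 < T" and smooth: "\<And>i. i \<le> 8 \<Longrightarrow> smooth_field T (g i)"
begin

lemma smooth_populations_dx: "smooth_populations T (\<lambda>i. dx a (g i))"
  using T_pos smooth by unfold_locales (auto intro: smooth_field_dx)

section \<open>Derivatives of density and momentum\<close>

lemma has_dx_momentum:
  "t \<in> {0..T} \<Longrightarrow> ((\<lambda>s. momentum g (x + s *\<^sub>R axis a 1) t) has_vector_derivative
    momentum (\<lambda>i. dx a (g i)) x t) (at 0)"
  unfolding momentum_def by (rule has_dx_sum_scaleR) (auto intro: smooth)

lemma has_dx_mass_density:
  "t \<in> {0..T} \<Longrightarrow> ((\<lambda>s. mass_density g (x + s *\<^sub>R axis a 1) t) has_vector_derivative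
    mass_density (\<lambda>i. dx a (g i)) x t) (at 0)"
  using has_dx_sum_scaleR[of "{..8}" T g t x a "\<lambda>_. 1 :: real"] smooth by (simp add: mass_density_def)

lemma has_dt_momentum:
  "t \<in> {0..T} \<Longrightarrow> (momentum g x has_vector_derivative
    momentum (\<lambda>i. dt T (g i)) x t) (at t within {0..T})"
  unfolding momentum_def[abs_def] by (rule has_dt_sum_scaleR) (auto intro: smooth)

lemma has_dt_mass_density:
  "t \<in> {0..T} \<Longrightarrow> (mass_density g x has_vector_derivative
    mass_density (\<lambda>i. dt T (g i)) x t) (at t within {0..T})"
  using has_dt_sum_scaleR[of "{..8}" T g t x "\<lambda>_. 1 :: real"] smooth by (simp add: mass_density_def[abs_def])

lemma dx_momentum:
  "t \<in> {0..T} \<Longrightarrow> dx a (momentum g) x t = momentum (\<lambda>i. dx a (g i)) x t"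
  by (rule dx_eqI, rule has_dx_momentum)

lemma dx_mass_density:
  "t \<in> {0..T} \<Longrightarrow> dx a (mass_density g) x t = mass_density (\<lambda>i. dx a (g i)) x t"
  by (rule dx_eqI, rule has_dx_mass_density)

lemma dt_momentum:
  "t \<in> {0..T} \<Longrightarrow> dt T (momentum g) x t = momentum (\<lambda>i. dt T (g i)) x t"
  by (rule dt_eqI[OF T_pos _ has_dt_momentum])

lemma dt_mass_density:
  "t \<in> {0..T} \<Longrightarrow> dt T (mass_density g) x t = mass_density (\<lambda>i. dt T (g i)) x t"
  by (rule dt_eqI[OF T_pos _ has_dt_mass_density])

text \<open>As a combination of the populations with constant coefficients, the linear equilibrium
  of their own moments commutes with differentiation.\<close>

lemma equilibrium_L_moments_eq:
  "equilibrium_L i (mass_density g x t) (momentum g x t)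
    = (\<Sum>j\<le>8. g j x t *\<^sub>R (weight i * (1 + 3 * (lattice_velocity i \<bullet> lattice_velocity j))))"
  by (simp add: equilibrium_L_def mass_density_def momentum_def inner_sum_right sum_distrib_left
      sum.distrib[symmetric] algebra_simps)

lemma dx_equilibrium:
  assumes eq: "\<And>y. g i y t = equilibrium_L i (mass_density g y t) (momentum g y t)"
    and t: "t \<in> {0..T}"
  shows "dx a (g i) x t = equilibrium_L i (mass_density (\<lambda>i. dx a (g i)) x t)
    (momentum (\<lambda>i. dx a (g i)) x t)"
proof -
  interpret dx: smooth_populations T "\<lambda>i. dx a (g i)" by (rule smooth_populations_dx)
  have "dx a (g i) x t
      = dx a (\<lambda>y s. \<Sum>j\<le>8. g j y s *\<^sub>R (weight i * (1 + 3 * (lattice_velocity i \<bullet> lattice_velocity j)))) x t"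
    by (rule dx_cong) (use eq equilibrium_L_moments_eq in simp)
  also have "\<dots> = equilibrium_L i (mass_density (\<lambda>i. dx a (g i)) x t) (momentum (\<lambda>i. dx a (g i)) x t)"
    unfolding dx.equilibrium_L_moments_eq using t by (intro dx_sum_scaleR) (auto intro: smooth)
  finally show ?thesis .
qed

section \<open>Regularity and bounds of strain, viscosity and viscous stress\<close>

lemma strain_momentum_eq_sum:
  assumes "t \<in> {0..T}"
  shows "strain (momentum g) x t = (\<Sum>p\<in>{..8} \<times> UNIV. dx (snd p) (g (fst p)) x t *\<^sub>R strain_dyad p)"
proof -
  have "strain (momentum g) x t $ a $ b =
      (\<Sum>i\<le>8. \<Sum>c\<in>UNIV. dx c (g i) x t * strain_dyad (i, c) $ a $ b)" for a b
    using exhaust_2[of a] exhaust_2[of b]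
    by (auto simp: strain_nth dx_momentum[OF assms] momentum_nth strain_dyad_def sum_2
        sum.distrib[symmetric] distrib_left add.commute)
  then show ?thesis
    by (simp add: vec_eq_iff sum.cartesian_product case_prod_beta)
qed

lemma has_dx_strain_momentum:
  assumes "t \<in> {0..T}"
  obtains D where "((\<lambda>s. strain (momentum g) (x + s *\<^sub>R axis a 1) t) has_vector_derivative D) (at 0)"
proof (rule that)
  show "((\<lambda>s. strain (momentum g) (x + s *\<^sub>R axis a 1) t) has_vector_derivative
      (\<Sum>p\<in>{..8} \<times> UNIV. dx a (dx (snd p) (g (fst p))) x t *\<^sub>R strain_dyad p)) (at 0)"
    unfolding strain_momentum_eq_sum[OF assms]
    using assms by (intro has_dx_sum_scaleR[where T = T]) (simp_all add: mem_Times_iff smooth smooth_field_dx)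
qed

lemma strain_momentum_bounded:
  assumes "\<And>i. i \<le> 8 \<Longrightarrow> spatially_periodic T (g i)" and "t \<in> {0..T}"
  obtains B where "\<And>x. norm (strain (momentum g) x t) \<le> B"
proof -
  obtain B where "\<And>x. norm (\<Sum>p\<in>{..8} \<times> UNIV. dx (snd p) (g (fst p)) x t *\<^sub>R strain_dyad p) \<le> B"
    by (rule bounded_sum_scaleR[of "{..8} \<times> UNIV" T "\<lambda>p. dx (snd p) (g (fst p))" t strain_dyad])
       (use assms in \<open>auto simp: smooth smooth_field_dx spatially_periodic_dx\<close>)
  then show thesis
    by (intro that) (simp add: strain_momentum_eq_sum[OF assms(2)])
qed

text \<open>\<open>tr (S^2)\<close> is the sum of the four squared entries of the strain. Bounded
  strain confines it to a compact interval, on which \<open>\<mu>\<close> is continuous.\<close>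

lemma viscosity_bounded:
  assumes "\<And>i. i \<le> 8 \<Longrightarrow> spatially_periodic T (g i)" and t: "t \<in> {0..T}"
    and \<mu>: "smooth_on_halfline \<mu>"
  obtains B where "\<And>x. \<mu> (trace (strain (momentum g) x t ** strain (momentum g) x t)) \<le> B"
proof -
  define q where "q x = trace (strain (momentum g) x t ** strain (momentum g) x t)" for x
  obtain B where B: "\<And>x. norm (strain (momentum g) x t) \<le> B"
    using strain_momentum_bounded[OF assms(1) t] by blast
  have "q x \<in> {0..4 * B\<^sup>2}" for x
  proof -
    have "\<bar>strain (momentum g) x t $ a $ b\<bar> \<le> B" for a b
    proof -
      have "\<bar>strain (momentum g) x t $ a $ b\<bar> \<le> norm (strain (momentum g) x t $ a)"
        by (rule component_le_norm_cart)
      also have "\<dots> \<le> norm (strain (momentum g) x t)"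
        by (rule Finite_Cartesian_Product.norm_nth_le)
      finally show ?thesis using B[of x] by simp
    qed
    then have "(strain (momentum g) x t $ a $ b)\<^sup>2 \<le> B\<^sup>2" for a b
      by (simp add: abs_le_square_iff[symmetric] order_trans[OF _ abs_ge_self])
    then have "q x \<le> (\<Sum>a\<in>(UNIV::2 set). \<Sum>b\<in>(UNIV::2 set). B\<^sup>2)"
      unfolding q_def trace_strain_square by (intro sum_mono)
    then show ?thesis
      by (auto simp: q_def trace_strain_square intro!: sum_nonneg)
  qed
  moreover have "compact (\<mu> ` {0..4 * B\<^sup>2})"
    using differentiable_imp_continuous_on[OF smooth_on_halfline_differentiable[OF \<mu>]]
    by (intro compact_continuous_image compact_Icc) (auto elim: continuous_on_subset)
  then obtain M where "\<And>y. y \<in> \<mu> ` {0..4 * B\<^sup>2} \<Longrightarrow> \<bar>y\<bar> \<le> M"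
    using compact_imp_bounded bounded_real by metis
  ultimately have "\<mu> (q x) \<le> M" for x
    by (meson abs_le_D1 imageI)
  then show thesis unfolding q_def by (rule that)
qed

text \<open>The trace is a sum of squares, hence a nonnegative differentiable function to which the
  half-line chain rule applies.\<close>

lemma has_dx_viscous_stress:
  assumes "t \<in> {0..T}" and \<mu>: "smooth_on_halfline \<mu>"
  obtains D where "((\<lambda>s. let S = strain (momentum g) (x + s *\<^sub>R axis a 1) t in \<mu> (trace (S ** S)) *\<^sub>R S)
    has_vector_derivative D) (at 0)"
proof -
  define S where "S s = strain (momentum g) (x + s *\<^sub>R axis a 1) t" for s
  obtain D where D: "(S has_vector_derivative D) (at 0)"
    using has_dx_strain_momentum[OF assms(1)] unfolding S_def by blast
  have nth: "((\<lambda>s. S s $ a $ b) has_vector_derivative D $ a $ b) (at 0)" for a b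
    by (intro bounded_linear.has_vector_derivative[OF bounded_linear_vec_nth] D)
  have tr: "trace (S s ** S s) = (\<Sum>a\<in>UNIV. \<Sum>b\<in>UNIV. (S s $ a $ b)\<^sup>2)" for s
    unfolding S_def by (rule trace_strain_square)
  have "(\<lambda>s. trace (S s ** S s)) differentiable (at 0)"
    unfolding tr using nth
    by (intro differentiable_sum differentiable_power finite ballI) (auto intro: differentiableI_vector)
  then have "(\<lambda>s. \<mu> (trace (S s ** S s))) differentiable (at 0)"
    by (intro differentiable_viscosity_compose[OF \<mu>]) (simp_all add: tr sum_nonneg)
  then have "(\<lambda>s. \<mu> (trace (S s ** S s)) *\<^sub>R S s) differentiable (at 0)"
    using D by (auto intro: derivative_intros differentiableI_vector)
  then show thesis
    using that unfolding S_def Let_def vector_derivative_works by blast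
qed

end

section \<open>The first orders of the expansion\<close>

locale d2q9_coefficients =
  fixes \<mu> :: "real \<Rightarrow> real" and T :: real and f :: "nat \<Rightarrow> nat \<Rightarrow> real field"
  assumes mu_smooth: "smooth_on_halfline \<mu>"
    and mu_nonneg: "\<And>s. 0 \<le> s \<Longrightarrow> 0 \<le> \<mu> s"
    and T_pos: "0 < T"
    and f_smooth: "\<And>n i. i \<le> 8 \<Longrightarrow> smooth_field T (f n i)"
    and f_periodic: "\<And>n i. i \<le> 8 \<Longrightarrow> spatially_periodic T (f n i)"
    and f_zero: "\<And>i x t. i \<le> 8 \<Longrightarrow> t \<in> {0..T} \<Longrightarrow> f 0 i x t = weight i"
begin

abbreviation "\<rho> n \<equiv> mass_density (f n)"
abbreviation "v n \<equiv> momentum (f n)"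
abbreviation "S n \<equiv> strain (momentum (f n))"
abbreviation "c \<equiv> lattice_velocity"

definition "\<nu> x t = \<mu> (trace (S 1 x t ** S 1 x t))"

lemma nu_nonneg: "0 \<le> \<nu> x t"
  unfolding \<nu>_def by (rule mu_nonneg) (simp add: trace_strain_square sum_nonneg)

sublocale f: smooth_populations T "f n" for n
  using T_pos f_smooth by unfold_locales auto

sublocale df: smooth_populations T "\<lambda>i. dx a (f n i)" for n a
  by (rule f.smooth_populations_dx)

lemma v_0: "t \<in> {0..T} \<Longrightarrow> v 0 x t = 0"
  by (simp add: vec_eq_iff forall_2 momentum_nth f_zero d2q9_simps)

lemma bgk_coeff_1:
  assumes "t \<in> {0..T}"
  shows "bgk_coeff f 1 i x t = - f 1 i x t + equilibrium_L i (\<rho> 1 x t) (v 1 x t)"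
proof -
  have "{(p, q). p + q = (1::nat)} = {(0, 1), (1, 0)}" by auto
  then show ?thesis
    using v_0[OF assms] by (simp add: bgk_coeff_def equilibrium_Q_def)
qed

lemma bgk_coeff_2:
  assumes "t \<in> {0..T}"
  shows "bgk_coeff f 2 i x t = - f 2 i x t + equilibrium_L i (\<rho> 2 x t) (v 2 x t)
    + equilibrium_Q i (v 1 x t) (v 1 x t)"
proof -
  have "{(p, q). p + q = (2::nat)} = {(0, 2), (1, 1), (2, 0)}" by auto
  then show ?thesis
    using v_0[OF assms] by (simp add: bgk_coeff_def equilibrium_Q_def)
qed

lemma lattice_taylor_f_0:
  "i \<le> 8 \<Longrightarrow> t \<in> {0..T} \<Longrightarrow> 1 \<le> n \<Longrightarrow> lattice_taylor T i n (f 0 i) x t = 0"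
  by (rule lattice_taylor_const[OF T_pos, where k = "weight i"]) (auto simp: f_zero)

lemma strain_v_0:
  assumes "t \<in> {0..T}"
  shows "S 0 x t = 0"
  using dx_cong[of "v 0" t "\<lambda>_ _. 0"] v_0[OF assms] by (simp add: vec_eq_iff strain_nth)

end

text \<open>The orders \<open>k \<le> 3\<close> of both hierarchies have the following common form: \<open>P\<close> is the leading
  coefficient of the relaxation time, \<open>A\<^sub>0\<close> that of the coupling to the strain, and \<open>Q\<close>, \<open>A\<^sub>1\<close> are
  next-order coefficients that drop out of the conserved moments. The limit only sees the combination
  \<open>P - 2/3 A\<^sub>0 = 3 \<mu> + 1/2\<close>.\<close>

locale d2q9_expansion = d2q9_coefficients \<mu> T f
  for \<mu> :: "real \<Rightarrow> real" and T :: real and f :: "nat \<Rightarrow> nat \<Rightarrow> real field" +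
  fixes P Q A\<^sub>0 A\<^sub>1 :: "real field" and \<kappa> :: real
  assumes order_1: "\<And>i x t. i \<le> 8 \<Longrightarrow> t \<in> {0..T} \<Longrightarrow> bgk_coeff f 1 i x t = 0"
    and order_2: "\<And>i x t. i \<le> 8 \<Longrightarrow> t \<in> {0..T} \<Longrightarrow>
      P x t * dir_deriv (lattice_velocity i) (f 1 i) x t
      = bgk_coeff f 2 i x t
        + A\<^sub>0 x t * (weight i * contraction (strain (momentum (f 1)) x t) (velocity_outer i))"
    and order_3: "\<And>i x t. i \<le> 8 \<Longrightarrow> t \<in> {0..T} \<Longrightarrow>
      P x t * (dir_deriv (lattice_velocity i) (f 2 i) x t + lattice_taylor T i 2 (f 1 i) x t)
        + Q x t * dir_deriv (lattice_velocity i) (f 1 i) x t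
      = bgk_coeff f 3 i x t
        + A\<^sub>0 x t * (weight i * contraction (strain (momentum (f 2)) x t) (velocity_outer i))
        + A\<^sub>1 x t * (weight i * contraction (strain (momentum (f 1)) x t) (velocity_outer i))"
    and kappa_pos: "0 < \<kappa>" and P_ge: "\<And>x t. t \<in> {0..T} \<Longrightarrow> \<kappa> \<le> P x t"
    and P_A\<^sub>0: "\<And>x t. t \<in> {0..T} \<Longrightarrow> P x t - 2/3 * A\<^sub>0 x t =
      3 * \<mu> (trace (strain (momentum (f 1)) x t ** strain (momentum (f 1)) x t)) + 1/2"
begin

section \<open>Order 1: the linear equilibrium and its derivatives\<close>

lemma P_nonzero: "t \<in> {0..T} \<Longrightarrow> P x t \<noteq> 0"
  using P_ge[of t x] kappa_pos by auto

lemma f_1_equilibrium: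
  "i \<le> 8 \<Longrightarrow> t \<in> {0..T} \<Longrightarrow> f 1 i x t = equilibrium_L i (\<rho> 1 x t) (v 1 x t)"
  using order_1[of i t x] by (simp add: bgk_coeff_1 del: One_nat_def)

lemma dx_f_1:
  assumes "i \<le> 8" "t \<in> {0..T}"
  shows "dx a (f 1 i) x t = equilibrium_L i (dx a (\<rho> 1) x t) (dx a (v 1) x t)"
  using f.dx_equilibrium[OF f_1_equilibrium[OF assms] assms(2)]
  by (simp only: f.dx_mass_density[OF assms(2)] f.dx_momentum[OF assms(2)])

lemma dx_dx_momentum:
  "t \<in> {0..T} \<Longrightarrow> dx a (dx b (v n)) x t = momentum (\<lambda>i. dx a (dx b (f n i))) x t"
  using dx_cong[of "dx b (v n)" t "momentum (\<lambda>i. dx b (f n i))" a x] f.dx_momentum df.dx_momentum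
  by simp

lemma dx_dx_mass_density:
  "t \<in> {0..T} \<Longrightarrow> dx a (dx b (\<rho> n)) x t = mass_density (\<lambda>i. dx a (dx b (f n i))) x t"
  using dx_cong[of "dx b (\<rho> n)" t "mass_density (\<lambda>i. dx b (f n i))" a x] f.dx_mass_density df.dx_mass_density
  by simp

lemma dx_dx_f_1:
  assumes "i \<le> 8" "t \<in> {0..T}"
  shows "dx a (dx b (f 1 i)) x t = equilibrium_L i (dx a (dx b (\<rho> 1)) x t) (dx a (dx b (v 1)) x t)"
proof -
  have "dx b (f 1 i) y t = equilibrium_L i (mass_density (\<lambda>i. dx b (f 1 i)) y t)
      (momentum (\<lambda>i. dx b (f 1 i)) y t)" for y
    using dx_f_1[OF assms, of b y] by (simp only: f.dx_mass_density[OF assms(2)] f.dx_momentum[OF assms(2)])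
  then show ?thesis
    using df.dx_equilibrium[of b 1 i t a x] assms(2)
    by (simp only: dx_dx_mass_density[OF assms(2)] dx_dx_momentum[OF assms(2)])
qed

section \<open>Order 2: incompressibility, constant density and momentum flux\<close>

lemma dir_deriv_f_1:
  assumes "i \<le> 8" "t \<in> {0..T}"
  shows "dir_deriv (c i) (f 1 i) x t
    = (\<Sum>a\<in>UNIV. c i $ a * equilibrium_L i (dx a (\<rho> 1) x t) (dx a (v 1) x t))"
  by (simp only: dir_deriv_def dx_f_1[OF assms] real_scaleR_def)

lemma dir_deriv_f_1_moments:
  assumes "t \<in> {0..T}"
  shows "(\<Sum>i\<le>8. dir_deriv (c i) (f 1 i) x t) = divergence (v 1) x t"
    and "(\<Sum>i\<le>8. dir_deriv (c i) (f 1 i) x t * c i $ b) = dx b (\<rho> 1) x t / 3"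
    and "(\<Sum>i\<le>8. dir_deriv (c i) (f 1 i) x t * c i $ a * c i $ b)
      = (S 1 x t $ a $ b + (if a = b then divergence (v 1) x t else 0)) / 3"
  using advected_equilibrium_moments[of "\<lambda>a. dx a (\<rho> 1) x t" "\<lambda>a. dx a (v 1) x t"]
  by (simp_all add: dir_deriv_f_1[OF _ assms] divergence_def strain_nth del: One_nat_def cong: sum.cong_simp)

text \<open>In the mass balance of order 2 the strain coupling contributes through the trace of the
  strain, which is twice the divergence. The divergence is thus multiplied by
  \<open>P - 2/3 A\<^sub>0 = 3 \<nu> + 1/2\<close>, which is positive.\<close>

lemma div_v_1:
  assumes "t \<in> {0..T}"
  shows "divergence (v 1) x t = 0"
proof -
  have "(\<Sum>i\<le>8. P x t * dir_deriv (c i) (f 1 i) x t)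
      = (\<Sum>i\<le>8. bgk_coeff f 2 i x t + A\<^sub>0 x t * (weight i * contraction (S 1 x t) (velocity_outer i)))"
    by (rule sum.cong) (use order_2 assms in auto)
  then have "P x t * divergence (v 1) x t = A\<^sub>0 x t * (2 * divergence (v 1) x t / 3)"
    by (simp only: sum_distrib_left[symmetric] sum.distrib dir_deriv_f_1_moments[OF assms]
        bgk_conserves contraction_moments strain_diagonal)
  then have "(P x t - 2/3 * A\<^sub>0 x t) * divergence (v 1) x t = 0"
    by (simp add: algebra_simps)
  moreover have "P x t - 2/3 * A\<^sub>0 x t > 0"
    using P_A\<^sub>0[OF assms, of x] nu_nonneg[of x t] by (simp add: \<nu>_def)
  ultimately show ?thesis by simp
qed

text \<open>Collision and strain coupling have no first moment, so the momentum balance of order 2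
  consists of the pressure gradient times \<open>P\<close> alone.\<close>

lemma dx_rho_1:
  assumes "t \<in> {0..T}"
  shows "dx b (\<rho> 1) x t = 0"
proof -
  have "(\<Sum>i\<le>8. P x t * (dir_deriv (c i) (f 1 i) x t * c i $ b))
      = (\<Sum>i\<le>8. bgk_coeff f 2 i x t * c i $ b
          + A\<^sub>0 x t * (weight i * contraction (S 1 x t) (velocity_outer i) * c i $ b))"
  proof (rule sum.cong)
    fix i :: nat assume "i \<in> {..8}"
    then show "P x t * (dir_deriv (c i) (f 1 i) x t * c i $ b) = bgk_coeff f 2 i x t * c i $ b
        + A\<^sub>0 x t * (weight i * contraction (S 1 x t) (velocity_outer i) * c i $ b)"
      using arg_cong[OF order_2[OF _ assms, of i x], of "\<lambda>z. z * c i $ b"]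
      by (simp add: ring_distribs mult.assoc)
  qed simp
  then have "P x t * (dx b (\<rho> 1) x t / 3) = 0"
    by (simp only: sum_distrib_left[symmetric] sum.distrib dir_deriv_f_1_moments[OF assms]
        bgk_conserves contraction_moments)
  then show ?thesis
    using P_nonzero[OF assms] by simp
qed

text \<open>Order 2 expresses \<open>f 2\<close> through its equilibria and first derivatives of
  \<open>f 1\<close>. The strain enters with the factor \<open>- (P - 2/3 A\<^sub>0) / 3\<close>,
  and all trace terms vanish by \<open>div_v_1\<close>.\<close>

lemma momentum_flux_2:
  assumes "t \<in> {0..T}"
  shows "(\<Sum>i\<le>8. f 2 i x t * c i $ a * c i $ b)
    = (if a = b then \<rho> 2 x t / 3 else 0) + v 1 x t $ a * v 1 x t $ b - (\<nu> x t + 1/6) * S 1 x t $ a $ b"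
proof -
  have "(\<Sum>i\<le>8. f 2 i x t * c i $ a * c i $ b)
      = (\<Sum>i\<le>8. equilibrium_L i (\<rho> 2 x t) (v 2 x t) * c i $ a * c i $ b
          + equilibrium_Q i (v 1 x t) (v 1 x t) * c i $ a * c i $ b
          + A\<^sub>0 x t * (weight i * contraction (S 1 x t) (velocity_outer i) * c i $ a * c i $ b)
          - P x t * (dir_deriv (c i) (f 1 i) x t * c i $ a * c i $ b))"
  proof (rule sum.cong)
    fix i :: nat assume "i \<in> {..8}"
    then have "f 2 i x t = equilibrium_L i (\<rho> 2 x t) (v 2 x t) + equilibrium_Q i (v 1 x t) (v 1 x t)
        + A\<^sub>0 x t * (weight i * contraction (S 1 x t) (velocity_outer i))
        - P x t * dir_deriv (c i) (f 1 i) x t"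
      using order_2[OF _ assms, of i x] bgk_coeff_2[OF assms, of i x] by simp
    then show "f 2 i x t * c i $ a * c i $ b = equilibrium_L i (\<rho> 2 x t) (v 2 x t) * c i $ a * c i $ b
          + equilibrium_Q i (v 1 x t) (v 1 x t) * c i $ a * c i $ b
          + A\<^sub>0 x t * (weight i * contraction (S 1 x t) (velocity_outer i) * c i $ a * c i $ b)
          - P x t * (dir_deriv (c i) (f 1 i) x t * c i $ a * c i $ b)"
      by (simp only: ring_distribs mult.assoc)
  qed simp
  also have "\<dots> = (if a = b then \<rho> 2 x t / 3 else 0) + v 1 x t $ a * v 1 x t $ b
      + A\<^sub>0 x t * (2 * S 1 x t $ a $ b / 9) - P x t * (S 1 x t $ a $ b / 3)"
    by (simp add: sum_distrib_left[symmetric] sum.distrib sum_subtractf dir_deriv_f_1_moments[OF assms]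
        contraction_moments equilibrium_L_moments equilibrium_Q_moments strain_diagonal
        div_v_1[OF assms] strain_symmetric[of _ _ _ b a] del: One_nat_def)
  also have "\<dots> = (if a = b then \<rho> 2 x t / 3 else 0) + v 1 x t $ a * v 1 x t $ b
      - (P x t - 2/3 * A\<^sub>0 x t) / 3 * S 1 x t $ a $ b"
    by (simp add: field_simps)
  finally show ?thesis
    unfolding P_A\<^sub>0[OF assms] by (simp add: \<nu>_def add_divide_distrib)
qed

section \<open>Order 3: second-order Taylor terms and mass balance\<close>

lemma lattice_taylor_2_f_1_moments:
  assumes "t \<in> {0..T}"
  shows "(\<Sum>i\<le>8. lattice_taylor T i 2 (f 1 i) x t) = dt T (\<rho> 1) x t"
    and "(\<Sum>i\<le>8. lattice_taylor T i 2 (f 1 i) x t * c i $ b)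
      = (\<Sum>a\<in>UNIV. dx a (dx a (v 1)) x t $ b + dx a (dx b (v 1)) x t $ a) / 6 + dt T (v 1) x t $ b"
proof -
  define R where "R a b = dx a (dx b (\<rho> 1)) x t" for a b
  define U where "U a b = dx a (dx b (v 1)) x t" for a b
  have R: "R a b = 0" for a b
    using dx_cong[of "dx b (\<rho> 1)" t "\<lambda>_ _. 0" a x] by (simp add: R_def dx_rho_1[OF assms] del: One_nat_def)
  \<comment> \<open>With \<open>b\<close> as the outer differentiation, this sum is the derivative
    of the divergence of \<open>v 1\<close>.\<close>
  have U_div: "(\<Sum>a\<in>UNIV. U b a $ a) = 0" for b
  proof -
    have "dx b (divergence (v 1)) x t = (\<Sum>a\<in>UNIV. U b a $ a)"
    proof (rule dx_eqI)
      show "((\<lambda>s. divergence (v 1) (x + s *\<^sub>R axis b 1) t) has_vector_derivative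
          (\<Sum>a\<in>UNIV. U b a $ a)) (at 0)"
        unfolding divergence_def U_def dx_dx_momentum[OF assms] f.dx_momentum[OF assms]
        by (intro has_vector_derivative_sum bounded_linear.has_vector_derivative[OF bounded_linear_vec_nth]
            df.has_dx_momentum assms)
    qed
    then show ?thesis
      using dx_cong[of "divergence (v 1)" t "\<lambda>_ _. 0" b x] div_v_1[OF assms] by simp
  qed
  have LT: "lattice_taylor T i 2 (f 1 i) x t =
      (\<Sum>a\<in>UNIV. \<Sum>b\<in>UNIV. c i $ a * c i $ b * equilibrium_L i (R a b) (U a b)) / 2 + dt T (f 1 i) x t"
    if "i \<le> 8" for i
    using dir_deriv_twice[OF f_smooth[OF that] assms] dx_dx_f_1[OF that assms]
    by (simp only: lattice_taylor_2 R_def U_def)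
  have "(\<Sum>i\<le>8. lattice_taylor T i 2 (f 1 i) x t) = (\<Sum>i\<le>8.
      (\<Sum>a\<in>UNIV. \<Sum>b\<in>UNIV. c i $ a * c i $ b * equilibrium_L i (R a b) (U a b)) / 2 + dt T (f 1 i) x t)"
    by (rule sum.cong) (use LT in auto)
  then show "(\<Sum>i\<le>8. lattice_taylor T i 2 (f 1 i) x t) = dt T (\<rho> 1) x t"
    by (simp only: sum.distrib sum_divide_distrib[symmetric] twice_advected_equilibrium_moments R
        f.dt_mass_density[OF assms] mass_density_def) simp
  have "(\<Sum>i\<le>8. lattice_taylor T i 2 (f 1 i) x t * c i $ b) = (\<Sum>i\<le>8.
      (\<Sum>a\<in>UNIV. \<Sum>b\<in>UNIV. c i $ a * c i $ b * equilibrium_L i (R a b) (U a b)) * c i $ b / 2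
        + dt T (f 1 i) x t * c i $ b)"
    by (rule sum.cong) (use LT in \<open>auto simp: distrib_right\<close>)
  \<comment> \<open>The factor 1/6 is 1/2 from the Taylor coefficient times 1/3 from the lattice
    moments. \<open>U_div\<close> removes the middle term, and the other two form the divergence of
    \<open>S 1\<close>.\<close>
  then have "(\<Sum>i\<le>8. lattice_taylor T i 2 (f 1 i) x t * c i $ b) =
      (\<Sum>a\<in>UNIV. U a a $ b + U b a $ a + U a b $ a) / 6 + dt T (v 1) x t $ b"
    by (simp only: sum.distrib sum_divide_distrib[symmetric] twice_advected_equilibrium_moments
        f.dt_momentum[OF assms] momentum_nth)
  then show "(\<Sum>i\<le>8. lattice_taylor T i 2 (f 1 i) x t * c i $ b)
      = (\<Sum>a\<in>UNIV. dx a (dx a (v 1)) x t $ b + dx a (dx b (v 1)) x t $ a) / 6 + dt T (v 1) x t $ b"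
    using U_div[of b] by (simp add: sum.distrib U_def[symmetric] del: One_nat_def)
qed

text \<open>\<open>Q\<close> multiplies the divergence of \<open>v 1\<close> and
  \<open>A\<^sub>1\<close> the trace of \<open>S 1\<close>, so \<open>div_v_1\<close> eliminates
  both.\<close>

lemma order_3_moment_0:
  assumes "t \<in> {0..T}"
  shows "(3 * \<nu> x t + 1/2) * divergence (v 2) x t = - P x t * dt T (\<rho> 1) x t"
proof -
  have "(\<Sum>i\<le>8. dir_deriv (c i) (f 2 i) x t) = divergence (v 2) x t"
    unfolding dir_deriv_def divergence_def f.dx_momentum[OF assms] momentum_nth
    by (subst sum.swap) (simp add: mult.commute)
  moreover have "(\<Sum>i\<le>8. P x t * (dir_deriv (c i) (f 2 i) x t + lattice_taylor T i 2 (f 1 i) x t)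
        + Q x t * dir_deriv (c i) (f 1 i) x t)
      = (\<Sum>i\<le>8. bgk_coeff f 3 i x t
        + A\<^sub>0 x t * (weight i * contraction (S 2 x t) (velocity_outer i))
        + A\<^sub>1 x t * (weight i * contraction (S 1 x t) (velocity_outer i)))"
    by (rule sum.cong) (use order_3[OF _ assms, of _ x] in auto)
  ultimately have "P x t * (divergence (v 2) x t + dt T (\<rho> 1) x t) = A\<^sub>0 x t * (2 * divergence (v 2) x t / 3)"
    by (simp add: sum_distrib_left[symmetric] sum.distrib dir_deriv_f_1_moments[OF assms]
        lattice_taylor_2_f_1_moments[OF assms] bgk_conserves contraction_moments strain_diagonal
        div_v_1[OF assms] del: One_nat_def)
  then have "(P x t - 2/3 * A\<^sub>0 x t) * divergence (v 2) x t = - P x t * dt T (\<rho> 1) x t"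
    by (simp add: algebra_simps)
  then show ?thesis
    by (simp only: P_A\<^sub>0[OF assms] \<nu>_def)
qed

section \<open>Constancy of the first-order density\<close>

lemma rho_1_spatially_constant:
  assumes "t \<in> {0..T}"
  shows "\<rho> 1 x t = \<rho> 1 y t"
  by (rule dx_zero_imp_constant[of "\<lambda>x. \<rho> 1 x t"])
     (use f.has_dx_mass_density[OF assms, of 1, folded f.dx_mass_density[OF assms]] dx_rho_1[OF assms]
      in simp)

text \<open>The time derivative takes one value \<open>\<alpha>\<close> on the whole plane. If it
  were nonzero, \<open>order_3_moment_0\<close> would give the divergence of \<open>v 2\<close> a
  fixed sign and a positive lower bound in modulus, which is impossible for a bounded field.\<close>

lemma dt_rho_1:
  assumes t: "t \<in> {0..T}"
  shows "dt T (\<rho> 1) x t = 0"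
proof (rule ccontr)
  define \<alpha> where "\<alpha> = dt T (\<rho> 1) x t"
  assume "dt T (\<rho> 1) x t \<noteq> 0"
  then have "\<alpha> \<noteq> 0" by (simp add: \<alpha>_def)
  have \<alpha>: "dt T (\<rho> 1) y t = \<alpha>" for y
    unfolding \<alpha>_def by (rule dt_cong[OF rho_1_spatially_constant t])
  obtain B where B: "\<And>y. \<nu> y t \<le> B"
    using f.viscosity_bounded[OF f_periodic t mu_smooth, of 1] unfolding \<nu>_def by blast
  have "0 \<le> B" using nu_nonneg[of x t] B[of x] by simp
  obtain M where M: "\<And>y. norm (v 2 y t) \<le> M"
    unfolding momentum_def using bounded_sum_scaleR[of "{..8}" T "f 2" t c] f_smooth f_periodic t by auto
  \<comment> \<open>The sign that makes the divergence of \<open>\<sigma> * v 2\<close>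
    positive.\<close>
  define \<sigma> where "\<sigma> = - sgn \<alpha>"
  have d: "((\<lambda>s. \<sigma> * v 2 (y + s *\<^sub>R axis a 1) t $ a) has_vector_derivative \<sigma> * dx a (v 2) y t $ a) (at 0)" for a y
    unfolding f.dx_momentum[OF t]
    by (intro has_vector_derivative_mult_right bounded_linear.has_vector_derivative[OF bounded_linear_vec_nth]
        f.has_dx_momentum t)
  have cont_v: "continuous_on UNIV (\<lambda>y. \<sigma> * v 2 y t $ a)" for a
    unfolding momentum_nth using t
    by (intro continuous_intros smooth_field_continuous_slice[of T] f_smooth) auto
  have cont_dv: "continuous_on UNIV (\<lambda>y. \<sigma> * dx b (v 2) y t $ a)" for a b
    unfolding f.dx_momentum[OF t] momentum_nth using t
    by (intro continuous_intros smooth_field_continuous_slice[of T] smooth_field_dx f_smooth) auto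
  have bound: "\<bar>\<sigma> * v 2 y t $ a\<bar> \<le> M" for y a
    using component_le_norm_cart[of "v 2 y t" a] M[of y] \<open>\<alpha> \<noteq> 0\<close> by (simp add: \<sigma>_def abs_mult abs_sgn_eq)
  \<comment> \<open>The uniform bounds \<open>\<kappa> \<le> P\<close> and
    \<open>\<nu> \<le> B\<close> make the lower bound independent of the point.\<close>
  have "\<kappa> * \<bar>\<alpha>\<bar> / (3 * B + 1/2) \<le> \<sigma> * dx 1 (v 2) y t $ 1 + \<sigma> * dx 2 (v 2) y t $ 2" for y
  proof -
    have pos: "0 < 3 * \<nu> y t + 1/2" using nu_nonneg[of y t] by simp
    have "(3 * \<nu> y t + 1/2) * (\<sigma> * divergence (v 2) y t) = P y t * \<bar>\<alpha>\<bar>"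
    proof -
      have "(3 * \<nu> y t + 1/2) * (\<sigma> * divergence (v 2) y t) = \<sigma> * ((3 * \<nu> y t + 1/2) * divergence (v 2) y t)"
        by (rule mult.left_commute)
      also have "\<dots> = P y t * (\<alpha> * sgn \<alpha>)"
        unfolding order_3_moment_0[OF t] \<alpha> \<sigma>_def by simp
      finally show ?thesis by (simp only: abs_sgn)
    qed
    then have "\<sigma> * divergence (v 2) y t = P y t * \<bar>\<alpha>\<bar> / (3 * \<nu> y t + 1/2)"
      using pos by (simp add: field_simps)
    also have "\<dots> \<ge> \<kappa> * \<bar>\<alpha>\<bar> / (3 * B + 1/2)"
      using P_ge[OF t, of y] kappa_pos B[of y] pos by (intro frac_le mult_right_mono mult_nonneg_nonneg) auto
    finally show ?thesis
      by (simp add: divergence_def sum_2 distrib_left)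
  qed
  moreover have "0 < \<kappa> * \<bar>\<alpha>\<bar> / (3 * B + 1/2)"
    using kappa_pos \<open>\<alpha> \<noteq> 0\<close> \<open>0 \<le> B\<close> by simp
  ultimately show False
    using bounded_field_divergence_not_positive[OF d d cont_v cont_dv cont_dv bound bound] by blast
qed

lemma rho_1_constant:
  assumes "t \<in> {0..T}"
  shows "\<rho> 1 x t = \<rho> 1 x 0"
proof -
  have "(\<rho> 1 x has_vector_derivative 0) (at s within {0..T})" if "s \<in> {0..T}" for s
    using f.has_dt_mass_density[OF that, of 1 x] dt_rho_1[OF that, of x] f.dt_mass_density[OF that, of 1 x]
    by simp
  then obtain k where "\<And>s. s \<in> {0..T} \<Longrightarrow> \<rho> 1 x s = k"
    using has_vector_derivative_zero_constant[of "{0..T}" "\<rho> 1 x"] by (metis convex_real_interval(5))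
  then show ?thesis using assms T_pos by simp
qed

section \<open>Order 3: momentum balance\<close>

lemma order_3_moment_1:
  assumes "t \<in> {0..T}"
  shows "(\<Sum>i\<le>8. dir_deriv (c i) (f 2 i) x t * c i $ b)
    + (\<Sum>i\<le>8. lattice_taylor T i 2 (f 1 i) x t * c i $ b) = 0"
proof -
  have "(\<Sum>i\<le>8. P x t * (dir_deriv (c i) (f 2 i) x t * c i $ b + lattice_taylor T i 2 (f 1 i) x t * c i $ b)
        + Q x t * (dir_deriv (c i) (f 1 i) x t * c i $ b))
      = (\<Sum>i\<le>8. bgk_coeff f 3 i x t * c i $ b
        + A\<^sub>0 x t * (weight i * contraction (S 2 x t) (velocity_outer i) * c i $ b)
        + A\<^sub>1 x t * (weight i * contraction (S 1 x t) (velocity_outer i) * c i $ b))"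
  proof (rule sum.cong)
    fix i :: nat assume "i \<in> {..8}"
    then show "P x t * (dir_deriv (c i) (f 2 i) x t * c i $ b + lattice_taylor T i 2 (f 1 i) x t * c i $ b)
        + Q x t * (dir_deriv (c i) (f 1 i) x t * c i $ b) = bgk_coeff f 3 i x t * c i $ b
        + A\<^sub>0 x t * (weight i * contraction (S 2 x t) (velocity_outer i) * c i $ b)
        + A\<^sub>1 x t * (weight i * contraction (S 1 x t) (velocity_outer i) * c i $ b)"
      using arg_cong[OF order_3[OF _ assms, of i x], of "\<lambda>z. z * c i $ b"]
      by (simp add: ring_distribs mult.assoc)
  qed simp
  \<comment> \<open>The collision and both strain terms have zero first moment, and the
    \<open>Q\<close> term is a multiple of the gradient of \<open>\<rho> 1\<close>, which vanishes.
    What is left is \<open>P\<close> times the claim.\<close>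
  then show ?thesis
    using P_nonzero[OF assms, of x]
    by (simp add: sum_distrib_left[symmetric] sum.distrib dir_deriv_f_1_moments[OF assms]
        bgk_conserves contraction_moments dx_rho_1[OF assms] del: One_nat_def)
qed

text \<open>Differentiating \<open>momentum_flux_2\<close> along axis \<open>a\<close>. The excess
  \<open>S 1 / 6\<close> is written out in derivatives of \<open>v 1\<close> so that its derivative
  has the form found in \<open>lattice_taylor_2_f_1_moments\<close>, while \<open>\<nu> S 1\<close>
  stays whole as the stress of the limit equation.\<close>

lemma dx_momentum_flux_2:
  assumes t: "t \<in> {0..T}"
  shows "(\<Sum>i\<le>8. dx a (f 2 i) x t * c i $ a * c i $ b)
    = (if a = b then dx a (\<rho> 2) x t / 3 else 0)
      + (dx a (v 1) x t $ a * v 1 x t $ b + v 1 x t $ a * dx a (v 1) x t $ b)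
      - dx a (\<lambda>y s. \<nu> y s *\<^sub>R S 1 y s) x t $ a $ b
      - (dx a (dx a (v 1)) x t $ b + dx a (dx b (v 1)) x t $ a) / 6"
proof -
  note nth = bounded_linear.has_vector_derivative[OF bounded_linear_vec_nth]
  define D where "D = dx a (\<lambda>y s. \<nu> y s *\<^sub>R S 1 y s) x t"
  have D: "((\<lambda>s. \<nu> (x + s *\<^sub>R axis a 1) t *\<^sub>R S 1 (x + s *\<^sub>R axis a 1) t) has_vector_derivative D) (at 0)"
  proof -
    obtain D' where
      "((\<lambda>s. \<nu> (x + s *\<^sub>R axis a 1) t *\<^sub>R S 1 (x + s *\<^sub>R axis a 1) t) has_vector_derivative D') (at 0)"
      using f.has_dx_viscous_stress[OF t mu_smooth, of 1 x a] unfolding \<nu>_def Let_def by blast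
    then show ?thesis
      unfolding D_def by (intro dx_works[of "\<lambda>y s. \<nu> y s *\<^sub>R S 1 y s"] differentiableI_vector)
  qed
  have v: "((\<lambda>s. v 1 (x + s *\<^sub>R axis a 1) t $ b) has_vector_derivative dx a (v 1) x t $ b) (at 0)" for b
    unfolding f.dx_momentum[OF t] by (intro nth f.has_dx_momentum t)
  have dv: "((\<lambda>s. dx b (v 1) (x + s *\<^sub>R axis a 1) t $ d) has_vector_derivative dx a (dx b (v 1)) x t $ d) (at 0)" for b d
    unfolding dx_dx_momentum[OF t] f.dx_momentum[OF t] by (intro nth df.has_dx_momentum t)
  have \<rho>: "((\<lambda>s. \<rho> 2 (x + s *\<^sub>R axis a 1) t) has_vector_derivative dx a (\<rho> 2) x t) (at 0)"
    unfolding f.dx_mass_density[OF t] by (intro f.has_dx_mass_density t)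
  have "((\<lambda>s. \<Sum>i\<le>8. f 2 i (x + s *\<^sub>R axis a 1) t *\<^sub>R (c i $ a * c i $ b)) has_vector_derivative
      (\<Sum>i\<le>8. dx a (f 2 i) x t *\<^sub>R (c i $ a * c i $ b))) (at 0)"
    using t by (intro has_dx_sum_scaleR[where T = T] f_smooth) auto
  \<comment> \<open>The points \<open>x + 0 *\<^sub>R axis a 1\<close> are those at which the
    product rule evaluates its undifferentiated factors.\<close>
  moreover have "((\<lambda>s. (if a = b then \<rho> 2 (x + s *\<^sub>R axis a 1) t / 3 else 0)
      + v 1 (x + s *\<^sub>R axis a 1) t $ a * v 1 (x + s *\<^sub>R axis a 1) t $ b
      - (\<nu> (x + s *\<^sub>R axis a 1) t *\<^sub>R S 1 (x + s *\<^sub>R axis a 1) t) $ a $ b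
      - (dx a (v 1) (x + s *\<^sub>R axis a 1) t $ b + dx b (v 1) (x + s *\<^sub>R axis a 1) t $ a) / 6)
    has_vector_derivative (if a = b then dx a (\<rho> 2) x t / 3 else 0)
      + (v 1 (x + 0 *\<^sub>R axis a 1) t $ a * dx a (v 1) x t $ b + dx a (v 1) x t $ a * v 1 (x + 0 *\<^sub>R axis a 1) t $ b)
      - D $ a $ b
      - (dx a (dx a (v 1)) x t $ b + dx a (dx b (v 1)) x t $ a) / 6) (at 0)"
    by (intro has_vector_derivative_diff has_vector_derivative_add has_vector_derivative_mult
        has_vector_derivative_divide v dv nth D)
       (use has_vector_derivative_divide[OF \<rho>] in auto)
  moreover have "(\<Sum>i\<le>8. f 2 i y t *\<^sub>R (c i $ a * c i $ b)) = (if a = b then \<rho> 2 y t / 3 else 0)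
      + v 1 y t $ a * v 1 y t $ b - (\<nu> y t *\<^sub>R S 1 y t) $ a $ b
      - (dx a (v 1) y t $ b + dx b (v 1) y t $ a) / 6" for y
    using momentum_flux_2[OF t, of y a b] by (simp add: mult.assoc distrib_right strain_nth del: One_nat_def)
  ultimately show ?thesis
    by (auto dest: vector_derivative_unique_at simp: D_def mult.assoc add.commute)
qed

text \<open>When the two sums in \<open>order_3_moment_1\<close> are made explicit, the terms
  divided by 6 cancel. The derivative of \<open>v v\<close> gives the convective term plus
  \<open>v\<close> times its divergence, and the latter vanishes.\<close>

lemma navier_stokes:
  assumes t: "t \<in> {0..T}"
  shows "dt T (v 1) x t + grad (\<lambda>y s. \<rho> 2 y s / 3) x t + dir_deriv (v 1 x t) (v 1) x t
    = mat_divergence (\<lambda>y s. \<nu> y s *\<^sub>R S 1 y s) x t"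
proof -
  have pressure: "dx b (\<lambda>y s. \<rho> 2 y s / 3) x t = dx b (\<rho> 2) x t / 3" for b
    by (rule dx_eqI, rule has_vector_derivative_divide)
       (unfold f.dx_mass_density[OF t], intro f.has_dx_mass_density t)
  have "dt T (v 1) x t $ b + dx b (\<rho> 2) x t / 3 + (\<Sum>a\<in>UNIV. v 1 x t $ a * dx a (v 1) x t $ b)
    = (\<Sum>a\<in>UNIV. dx a (\<lambda>y s. \<nu> y s *\<^sub>R S 1 y s) x t $ a $ b)" for b
  proof -
    have "(\<Sum>i\<le>8. dir_deriv (c i) (f 2 i) x t * c i $ b)
        = (\<Sum>a\<in>UNIV. \<Sum>i\<le>8. dx a (f 2 i) x t * c i $ a * c i $ b)"
      unfolding dir_deriv_def sum_distrib_right by (subst sum.swap) (simp add: mult_ac)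
    also have "\<dots> = dx b (\<rho> 2) x t / 3 + divergence (v 1) x t * v 1 x t $ b
        + (\<Sum>a\<in>UNIV. v 1 x t $ a * dx a (v 1) x t $ b)
        - (\<Sum>a\<in>UNIV. dx a (\<lambda>y s. \<nu> y s *\<^sub>R S 1 y s) x t $ a $ b)
        - (\<Sum>a\<in>UNIV. dx a (dx a (v 1)) x t $ b + dx a (dx b (v 1)) x t $ a) / 6"
      unfolding dx_momentum_flux_2[OF t]
      by (simp add: sum.distrib sum_subtractf divergence_def sum_distrib_right sum_divide_distrib[symmetric] del: One_nat_def)
    finally show ?thesis
      using order_3_moment_1[OF t, of x b] lattice_taylor_2_f_1_moments(2)[OF t, of x b]
      by (simp add: div_v_1[OF t] del: One_nat_def)
  qed
  then show ?thesis
    by (simp add: pressure vec_eq_iff grad_def dir_deriv_def mat_divergence_def del: One_nat_def)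
qed

end

section \<open>The two hierarchies\<close>

context d2q9_coefficients
begin

lemma lattice_taylor_sums:
  assumes "i \<le> 8" "t \<in> {0..T}"
  shows "(\<Sum>s=1..2. lattice_taylor T i s (f (2 - s) i) x t) = dir_deriv (c i) (f 1 i) x t"
    and "(\<Sum>s=1..3. lattice_taylor T i s (f (3 - s) i) x t)
      = dir_deriv (c i) (f 2 i) x t + lattice_taylor T i 2 (f 1 i) x t"
proof -
  have "{1..2::nat} = {1, 2}" "{1..3::nat} = {1, 2, 3}" by auto
  then show "(\<Sum>s=1..2. lattice_taylor T i s (f (2 - s) i) x t) = dir_deriv (c i) (f 1 i) x t"
    and "(\<Sum>s=1..3. lattice_taylor T i s (f (3 - s) i) x t)
      = dir_deriv (c i) (f 2 i) x t + lattice_taylor T i 2 (f 1 i) x t"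
    by (simp_all add: lattice_taylor_1[unfolded One_nat_def] lattice_taylor_f_0[OF assms])
qed

text \<open>There is no strain coupling here, so \<open>P\<close> itself equals
  \<open>3 \<nu> + 1/2\<close>; since \<open>\<nu> \<ge> 0\<close>, the constant 1/2 is a uniform
  lower bound.\<close>

lemma hierarchy_I_expansion:
  assumes "solves_hierarchy_I \<mu> T f"
  shows "d2q9_expansion \<mu> T f (\<lambda>x t. fps_nth (relaxation_series \<mu> f x t) 0)
    (\<lambda>x t. fps_nth (relaxation_series \<mu> f x t) 1) (\<lambda>x t. 0) (\<lambda>x t. 0) (1/2)"
proof unfold_locales
  define F where "F r x t = fps_nth (relaxation_series \<mu> f x t) r" for r x t
  have hierarchy: "(\<Sum>(r, n)\<in>{(r, n). r + n = k \<and> 1 \<le> n}. F r x t *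
      (\<Sum>s=1..n. lattice_taylor T i s (f (n - s) i) x t)) = bgk_coeff f k i x t"
    if "i \<le> 8" "t \<in> {0..T}" for k i x t
    using assms that unfolding solves_hierarchy_I_def F_def by blast
  have F_0: "F 0 x t = 3 * \<nu> x t + 1/2" for x t
    by (simp add: F_def relaxation_series_def viscosity_series_nth_0 \<nu>_def)
  fix i :: nat and x :: "real^2" and t :: real
  assume t: "t \<in> {0..T}"
  show "1/2 \<le> fps_nth (relaxation_series \<mu> f x t) 0"
    using F_0[of x t] nu_nonneg[of x t] by (simp add: F_def)
  show "fps_nth (relaxation_series \<mu> f x t) 0 - 2/3 * 0 = 3 * \<mu> (trace (S 1 x t ** S 1 x t)) + 1/2"
    using F_0[of x t] by (simp add: F_def \<nu>_def)
  assume i: "i \<le> 8"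
  note zero = lattice_taylor_f_0[OF i t]
  have "{(r, n). r + n = (1::nat) \<and> 1 \<le> n} = {(0, 1)}" by auto
  then show "bgk_coeff f 1 i x t = 0"
    using hierarchy[OF i t, where k = 1 and x = x] by (simp add: zero)
  have "{(r, n). r + n = (2::nat) \<and> 1 \<le> n} = {(0, 2), (1, 1)}" by auto
  then show "fps_nth (relaxation_series \<mu> f x t) 0 * dir_deriv (c i) (f 1 i) x t
      = bgk_coeff f 2 i x t + 0 * (weight i * contraction (S 1 x t) (velocity_outer i))"
    using hierarchy[OF i t, where k = 2 and x = x]
    by (simp add: zero lattice_taylor_sums[OF i t] F_def del: One_nat_def)
  \<comment> \<open>The pair \<open>(2, 1)\<close> carries derivatives of \<open>f 0\<close> only,
    so the coefficient \<open>F 2\<close> drops out.\<close>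
  have "{(r, n). r + n = (3::nat) \<and> 1 \<le> n} = {(0, 3), (1, 2), (2, 1)}" by auto
  then show "fps_nth (relaxation_series \<mu> f x t) 0 *
      (dir_deriv (c i) (f 2 i) x t + lattice_taylor T i 2 (f 1 i) x t)
        + fps_nth (relaxation_series \<mu> f x t) 1 * dir_deriv (c i) (f 1 i) x t
      = bgk_coeff f 3 i x t
        + 0 * (weight i * contraction (S 2 x t) (velocity_outer i))
        + 0 * (weight i * contraction (S 1 x t) (velocity_outer i))"
    using hierarchy[OF i t, where k = 3 and x = x]
    by (simp add: zero lattice_taylor_sums[OF i t] F_def del: One_nat_def)
qed simp

text \<open>\<open>P\<close> is the constant \<open>\<tau>\<close>, and \<open>A\<close> is designed
  so that \<open>\<tau> - 2/3 A\<close> recovers the relaxation time \<open>3 \<mu> + 1/2\<close> of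
  the first model.\<close>

lemma hierarchy_II_expansion:
  assumes "0 < \<tau>" "solves_hierarchy_II \<mu> \<tau> T f"
  shows "d2q9_expansion \<mu> T f (\<lambda>x t. \<tau>) (\<lambda>x t. 0)
    (\<lambda>x t. fps_nth (strain_coupling_series \<mu> \<tau> f x t) 0)
    (\<lambda>x t. fps_nth (strain_coupling_series \<mu> \<tau> f x t) 1) \<tau>"
proof unfold_locales
  define A where "A r x t = fps_nth (strain_coupling_series \<mu> \<tau> f x t) r" for r x t
  have hierarchy: "\<tau> * (\<Sum>s=1..k. lattice_taylor T i s (f (k - s) i) x t)
    = bgk_coeff f k i x t + (\<Sum>(a, b)\<in>{(a, b). a + b + 1 = k}.
        weight i * A a x t * contraction (S b x t) (velocity_outer i))"
    if "i \<le> 8" "t \<in> {0..T}" for k i x t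
    using assms(2) that unfolding solves_hierarchy_II_def A_def by blast
  fix i :: nat and x :: "real^2" and t :: real
  assume t: "t \<in> {0..T}"
  show "\<tau> - 2/3 * fps_nth (strain_coupling_series \<mu> \<tau> f x t) 0
      = 3 * \<mu> (trace (S 1 x t ** S 1 x t)) + 1/2"
    by (simp add: strain_coupling_series_def viscosity_series_nth_0 field_simps)
  assume i: "i \<le> 8"
  note zero = lattice_taylor_f_0[OF i t] strain_v_0[OF t]
  have contraction_0: "contraction 0 M = 0" for M
    by (simp add: contraction_def)
  \<comment> \<open>The strain of order 0 vanishes. Hence the coupling is absent at order 1, and at
    each later order the pair with \<open>b = 0\<close> contributes nothing.\<close>
  have "{(a, b). a + b + 1 = (1::nat)} = {(0, 0)}" by auto
  then show "bgk_coeff f 1 i x t = 0"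
    using hierarchy[OF i t, where k = 1 and x = x] by (simp add: zero contraction_0)
  have "{(a, b). a + b + 1 = (2::nat)} = {(0, 1), (1, 0)}" by auto
  then show "\<tau> * dir_deriv (c i) (f 1 i) x t = bgk_coeff f 2 i x t
      + fps_nth (strain_coupling_series \<mu> \<tau> f x t) 0 * (weight i * contraction (S 1 x t) (velocity_outer i))"
    using hierarchy[OF i t, where k = 2 and x = x]
    by (simp add: zero contraction_0 lattice_taylor_sums[OF i t] A_def del: One_nat_def)
  have "{(a, b). a + b + 1 = (3::nat)} = {(0, 2), (1, 1), (2, 0)}" by auto
  then show "\<tau> * (dir_deriv (c i) (f 2 i) x t + lattice_taylor T i 2 (f 1 i) x t)
        + 0 * dir_deriv (c i) (f 1 i) x t
      = bgk_coeff f 3 i x t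
        + fps_nth (strain_coupling_series \<mu> \<tau> f x t) 0 * (weight i * contraction (S 2 x t) (velocity_outer i))
        + fps_nth (strain_coupling_series \<mu> \<tau> f x t) 1 * (weight i * contraction (S 1 x t) (velocity_outer i))"
    using hierarchy[OF i t, where k = 3 and x = x]
    by (simp add: zero contraction_0 lattice_taylor_sums[OF i t] A_def del: One_nat_def)
qed (use assms in simp_all)

end

theorem mainTheorem2:
  fixes \<mu> :: "real \<Rightarrow> real"
    and T :: real
    and f :: "nat \<Rightarrow> nat \<Rightarrow> real field"
  assumes mu_smooth: "smooth_on_halfline \<mu>"
    and mu_nonneg: "\<And>s. 0 \<le> s \<Longrightarrow> 0 \<le> \<mu> s"
    and T_pos: "0 < T"
    and f_smooth: "\<And>n i. i \<le> 8 \<Longrightarrow> smooth_field T (f n i)"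
    and f_periodic: "\<And>n i. i \<le> 8 \<Longrightarrow> spatially_periodic T (f n i)"
    and f_zero: "\<And>i x t. i \<le> 8 \<Longrightarrow> t \<in> {0..T} \<Longrightarrow> f 0 i x t = weight i"
    and lbe: "solves_hierarchy_I \<mu> T f \<or> (\<exists>\<tau>>0. solves_hierarchy_II \<mu> \<tau> T f)"
    and rho1_init: "\<And>x. mass_density (f 1) x 0 = 0"
  defines "\<rho> \<equiv> \<lambda>n. mass_density (f n)"
    and "v \<equiv> \<lambda>n. momentum (f n)"
    and "S \<equiv> \<lambda>n. strain (momentum (f n))"
  shows "\<forall>x. \<forall>t\<in>{0..T}.
           \<rho> 1 x t = 0 \<and>
           divergence (v 1) x t = 0 \<and>
           dt T (v 1) x t + grad (\<lambda>y s. \<rho> 2 y s / 3) x t + dir_deriv (v 1 x t) (v 1) x t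
             = mat_divergence (\<lambda>y s. \<mu> (trace (S 1 y s ** S 1 y s)) *\<^sub>R S 1 y s) x t"
proof -
  interpret d2q9_coefficients \<mu> T f
    using mu_smooth mu_nonneg T_pos f_smooth f_periodic f_zero by unfold_locales
  obtain P Q A\<^sub>0 A\<^sub>1 \<kappa> where "d2q9_expansion \<mu> T f P Q A\<^sub>0 A\<^sub>1 \<kappa>"
    using lbe hierarchy_I_expansion hierarchy_II_expansion by blast
  then interpret d2q9_expansion \<mu> T f P Q A\<^sub>0 A\<^sub>1 \<kappa> .
  show ?thesis
    unfolding \<rho>_def v_def S_def
    using rho_1_constant rho1_init div_v_1 navier_stokes by (simp add: \<nu>_def del: One_nat_def)
qed

end
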